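(* Let $k$ be an algebraically closed field of characteristic $2$. The Cartan matrix of the group algebra $k(C_2\times C_2)$ of the Klein four-group is the $1\times 1$ matrix $[4]$.
   Context: For a finite-dimensional $k$-algebra $A$, the Cartan matrix is the matrix $(C_{ST})$ with rows and columns indexed by isomorphism types of simple left $A$-modules, where $C_{ST}$ is the multiplicity of $S$ as a composition factor of the projective cover $P_T$ of $T$. *)

theory Defs
  imports "HOL-Algebra.Module" "HOL-Algebra.AbelCoset" "HOL-Algebra.Elementary_Groups"
    "HOL-Computational_Algebra.Polynomial"
begin

section \<open>Left modules over a not necessarily commutative ring\<close>

text \<open>The locale \<open>module\<close> of HOL-Algebra assumes a commutative ring of scalars. The record type
  is reused here; its fields \<open>mult\<close> and \<open>one\<close> play no role for a left module.\<close>

locale left_module = R?: ring R + M?: abelian_group M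
  for R :: "('a, 'r) ring_scheme" (structure) and M :: "('a, 'm, 's) module_scheme" (structure) +
  assumes smult_closed [simp, intro]:
      "\<lbrakk>a \<in> carrier R; x \<in> carrier M\<rbrakk> \<Longrightarrow> a \<odot>\<^bsub>M\<^esub> x \<in> carrier M"
    and smult_l_distr:
      "\<lbrakk>a \<in> carrier R; b \<in> carrier R; x \<in> carrier M\<rbrakk> \<Longrightarrow>
        (a \<oplus> b) \<odot>\<^bsub>M\<^esub> x = a \<odot>\<^bsub>M\<^esub> x \<oplus>\<^bsub>M\<^esub> b \<odot>\<^bsub>M\<^esub> x"
    and smult_r_distr:
      "\<lbrakk>a \<in> carrier R; x \<in> carrier M; y \<in> carrier M\<rbrakk> \<Longrightarrow>
        a \<odot>\<^bsub>M\<^esub> (x \<oplus>\<^bsub>M\<^esub> y) = a \<odot>\<^bsub>M\<^esub> x \<oplus>\<^bsub>M\<^esub> a \<odot>\<^bsub>M\<^esub> y"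
    and smult_assoc:
      "\<lbrakk>a \<in> carrier R; b \<in> carrier R; x \<in> carrier M\<rbrakk> \<Longrightarrow>
        (a \<otimes> b) \<odot>\<^bsub>M\<^esub> x = a \<odot>\<^bsub>M\<^esub> (b \<odot>\<^bsub>M\<^esub> x)"
    and smult_one [simp]:
      "x \<in> carrier M \<Longrightarrow> \<one> \<odot>\<^bsub>M\<^esub> x = x"

definition left_module_hom ::
    "('a, 'r) ring_scheme \<Rightarrow> ('a, 'm, 's) module_scheme \<Rightarrow> ('a, 'n, 't) module_scheme \<Rightarrow> ('m \<Rightarrow> 'n) set"
  where "left_module_hom R M N = {f \<in> carrier M \<rightarrow> carrier N.
    (\<forall>x\<in>carrier M. \<forall>y\<in>carrier M. f (x \<oplus>\<^bsub>M\<^esub> y) = f x \<oplus>\<^bsub>N\<^esub> f y) \<and>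
    (\<forall>a\<in>carrier R. \<forall>x\<in>carrier M. f (a \<odot>\<^bsub>M\<^esub> x) = a \<odot>\<^bsub>N\<^esub> f x)}"

definition left_module_iso ::
    "('a, 'r) ring_scheme \<Rightarrow> ('a, 'm, 's) module_scheme \<Rightarrow> ('a, 'n, 't) module_scheme \<Rightarrow> bool"
  where "left_module_iso R M N \<longleftrightarrow> (\<exists>f\<in>left_module_hom R M N. bij_betw f (carrier M) (carrier N))"

definition left_submodule :: "('a, 'r) ring_scheme \<Rightarrow> ('a, 'm, 's) module_scheme \<Rightarrow> 'm set \<Rightarrow> bool"
  where "left_submodule R M N \<longleftrightarrow>
    additive_subgroup N M \<and> (\<forall>a\<in>carrier R. \<forall>x\<in>N. a \<odot>\<^bsub>M\<^esub> x \<in> N)"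

definition quotient_module :: "('a, 'm, 's) module_scheme \<Rightarrow> 'm set \<Rightarrow> ('a, 'm set) module"
  where "quotient_module M N =
    \<lparr>carrier = a_rcosets\<^bsub>M\<^esub> N, monoid.mult = undefined, monoid.one = undefined,
     ring.zero = N, ring.add = set_add M,
     module.smult = (\<lambda>a C. N <+>\<^bsub>M\<^esub> (\<lambda>x. a \<odot>\<^bsub>M\<^esub> x) ` C)\<rparr>"

definition simple_module :: "('a, 'r) ring_scheme \<Rightarrow> ('a, 'm, 's) module_scheme \<Rightarrow> bool"
  where "simple_module R M \<longleftrightarrow> left_module R M \<and> carrier M \<noteq> {\<zero>\<^bsub>M\<^esub>} \<and>
    (\<forall>N. left_submodule R M N \<longrightarrow> N = {\<zero>\<^bsub>M\<^esub>} \<or> N = carrier M)"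


section \<open>Composition multiplicities\<close>

definition series_factor :: "('a, 'm) module \<Rightarrow> 'm set list \<Rightarrow> nat \<Rightarrow> ('a, 'm set) module"
  where "series_factor M Ns i = quotient_module (M\<lparr>carrier := Ns ! Suc i\<rparr>) (Ns ! i)"

definition composition_series :: "('a, 'r) ring_scheme \<Rightarrow> ('a, 'm) module \<Rightarrow> 'm set list \<Rightarrow> bool"
  where "composition_series R M Ns \<longleftrightarrow>
    Ns \<noteq> [] \<and> hd Ns = {\<zero>\<^bsub>M\<^esub>} \<and> last Ns = carrier M \<and> (\<forall>N\<in>set Ns. left_submodule R M N) \<and>
    (\<forall>i. Suc i < length Ns \<longrightarrow> Ns ! i \<subseteq> Ns ! Suc i \<and> simple_module R (series_factor M Ns i))"

text \<open>Well defined for modules of finite length, by the Jordan--Hoelder theorem.\<close>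

definition composition_multiplicity ::
    "('a, 'r) ring_scheme \<Rightarrow> ('a, 'm) module \<Rightarrow> ('a, 'n) module \<Rightarrow> nat"
  where "composition_multiplicity R M S = (THE n. \<exists>Ns. composition_series R M Ns \<and>
    n = card {i. Suc i < length Ns \<and> left_module_iso R S (series_factor M Ns i)})"


section \<open>Projective covers\<close>

text \<open>The lifting property has to be tested on modules whose carriers live in fixed types. The
  types chosen have room for the free module on the set \<open>carrier P\<close>, so that the restriction is
  harmless: see \<open>projective_module_lift\<close> below.\<close>

definition projective_module :: "('a, 'r) ring_scheme \<Rightarrow> ('a, 'm) module \<Rightarrow> bool"
  where "projective_module R P \<longleftrightarrow> left_module R P \<and>
    (\<forall>(M :: ('a, 'm \<Rightarrow> 'a) module) (N :: ('a, 'm) module). \<forall>g\<in>left_module_hom R M N. \<forall>f\<in>left_module_hom R P N.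
      left_module R M \<and> left_module R N \<and> g ` carrier M = carrier N \<longrightarrow>
      (\<exists>h\<in>left_module_hom R P M. \<forall>x\<in>carrier P. g (h x) = f x))"

definition essential_epi ::
    "('a, 'r) ring_scheme \<Rightarrow> ('a, 'm) module \<Rightarrow> ('a, 'n) module \<Rightarrow> ('m \<Rightarrow> 'n) \<Rightarrow> bool"
  where "essential_epi R M N f \<longleftrightarrow> f \<in> left_module_hom R M N \<and> f ` carrier M = carrier N \<and>
    (\<forall>L. left_submodule R M L \<and> f ` L = carrier N \<longrightarrow> L = carrier M)"

definition projective_cover ::
    "('a, 'r) ring_scheme \<Rightarrow> ('a, 'n) module \<Rightarrow> ('a, 'm) module \<Rightarrow> ('m \<Rightarrow> 'n) \<Rightarrow> bool"
  where "projective_cover R T P f \<longleftrightarrow> projective_module R P \<and> essential_epi R P T f"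


section \<open>The Cartan matrix\<close>

text \<open>Simple modules and their projective covers are cyclic, hence have isomorphic copies whose
  carriers are subsets of the carrier of the ring: see \<open>simple_module_copy\<close> and
  \<open>projective_cover_copy\<close> below. So modules on the element type of the ring suffice.\<close>

definition simple_module_types :: "('a, 'r) ring_scheme \<Rightarrow> ('a, 'a) module set set"
  where "simple_module_types R =
    {{T. simple_module R T \<and> left_module_iso R S T} | S :: ('a, 'a) module. simple_module R S}"

text \<open>For a finite-dimensional algebra the value depends neither on the representatives \<open>S\<close>, \<open>T\<close> nor
  on the projective cover. It is the multiplicity of \<open>S\<close> in the projective cover of \<open>T\<close>.\<close>

definition cartan_matrix ::
    "('a, 'r) ring_scheme \<Rightarrow> ('a, 'a) module set \<Rightarrow> ('a, 'a) module set \<Rightarrow> nat"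
  where "cartan_matrix R \<S> \<T> = (THE n. \<exists>S\<in>\<S>. \<exists>T\<in>\<T>. \<exists>(P :: ('a, 'a) module) f.
    projective_cover R T P f \<and> n = composition_multiplicity R P S)"


section \<open>The group algebra of the Klein four-group\<close>

definition group_algebra :: "('g, 'b) monoid_scheme \<Rightarrow> ('k::field, 'g \<Rightarrow> 'k) module"
  where "group_algebra G =
    \<lparr>carrier = {f. finite {x. f x \<noteq> 0} \<and> {x. f x \<noteq> 0} \<subseteq> carrier G},
     monoid.mult = (\<lambda>f g x. if x \<in> carrier G
        then \<Sum>y | f y \<noteq> 0. f y * g (inv\<^bsub>G\<^esub> y \<otimes>\<^bsub>G\<^esub> x) else 0),
     monoid.one = (\<lambda>x. if x = \<one>\<^bsub>G\<^esub> then 1 else 0),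
     ring.zero = (\<lambda>x. 0),
     ring.add = (\<lambda>f g x. f x + g x),
     module.smult = (\<lambda>c f x. c * f x)\<rparr>"

abbreviation klein_four_group :: "(int \<times> int) monoid"
  where "klein_four_group \<equiv> integer_mod_group 2 \<times>\<times> integer_mod_group 2"


section \<open>Sanity checks\<close>

lemma group_algebra_ring:
  fixes G (structure)
  assumes "group G"
  shows "ring (group_algebra G :: ('k::field, 'g \<Rightarrow> 'k) module)"
proof -
  interpret group G by fact
  let ?A = "group_algebra G :: ('k, 'g \<Rightarrow> 'k) module"
  have mult_on: "(f \<otimes>\<^bsub>?A\<^esub> g) x = (\<Sum>y\<in>B. f y * g (inv y \<otimes> x))"
    if "x \<in> carrier G" "finite B" "{y. f y \<noteq> 0} \<subseteq> B" for f g :: "'g \<Rightarrow> 'k" and x B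
    using that by (auto simp: group_algebra_def intro!: sum.mono_neutral_left)
  have mult_out: "(f \<otimes>\<^bsub>?A\<^esub> g) x = 0" if "x \<notin> carrier G" for f g :: "'g \<Rightarrow> 'k" and x
    using that by (simp add: group_algebra_def)
  have out: "f x = 0" if "f \<in> carrier ?A" "x \<notin> carrier G" for f x
    using that by (auto simp: group_algebra_def)
  have fin: "finite {x. f x \<noteq> 0}" "{x. f x \<noteq> 0} \<subseteq> carrier G" if "f \<in> carrier ?A" for f
    using that by (auto simp: group_algebra_def)
  have supp: "{x. (f \<otimes>\<^bsub>?A\<^esub> g) x \<noteq> 0} \<subseteq> (\<lambda>(y, z). y \<otimes> z) ` ({x. f x \<noteq> 0} \<times> {x. g x \<noteq> 0})"
    if f: "f \<in> carrier ?A" and g: "g \<in> carrier ?A" for f g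
  proof
    fix x assume "x \<in> {x. (f \<otimes>\<^bsub>?A\<^esub> g) x \<noteq> 0}"
    then have x: "x \<in> carrier G" and nz: "(\<Sum>y | f y \<noteq> 0. f y * g (inv y \<otimes> x)) \<noteq> 0"
      by (auto simp: group_algebra_def split: if_splits)
    from nz obtain y where y: "f y \<noteq> 0" "g (inv y \<otimes> x) \<noteq> 0"
      by (metis (mono_tags, lifting) mem_Collect_eq mult_zero_right sum.neutral)
    then have "y \<in> carrier G" using fin(2)[OF f] by auto
    then have "x = y \<otimes> (inv y \<otimes> x)" using x by (simp add: m_assoc[symmetric])
    then show "x \<in> (\<lambda>(y, z). y \<otimes> z) ` ({x. f x \<noteq> 0} \<times> {x. g x \<noteq> 0})" using y by force
  qed
  have closed: "f \<otimes>\<^bsub>?A\<^esub> g \<in> carrier ?A" if "f \<in> carrier ?A" "g \<in> carrier ?A" for f g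
  proof -
    have "finite {x. (f \<otimes>\<^bsub>?A\<^esub> g) x \<noteq> 0}"
      by (rule finite_subset[OF supp[OF that]]) (use fin that in auto)
    moreover have "{x. (f \<otimes>\<^bsub>?A\<^esub> g) x \<noteq> 0} \<subseteq> carrier G" using mult_out by blast
    ultimately show ?thesis by (simp add: group_algebra_def)
  qed
  have add: "(f \<oplus>\<^bsub>?A\<^esub> g) x = f x + g x" for f g x by (simp add: group_algebra_def)
  have add_supp: "{x. f x + g x \<noteq> 0} \<subseteq> {x. f x \<noteq> 0} \<union> {x. g x \<noteq> 0}" for f g :: "'g \<Rightarrow> 'k"
    by auto
  have add_closed: "f \<oplus>\<^bsub>?A\<^esub> g \<in> carrier ?A" if "f \<in> carrier ?A" "g \<in> carrier ?A" for f g
  proof -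
    have "finite {x. f x + g x \<noteq> 0}"
      by (rule finite_subset[OF add_supp]) (use fin that in auto)
    moreover have "{x. f x + g x \<noteq> 0} \<subseteq> carrier G"
      using add_supp[of f g] fin(2)[OF that(1)] fin(2)[OF that(2)] by blast
    ultimately show ?thesis by (simp add: group_algebra_def)
  qed
  show ?thesis
  proof (rule ringI)
    show "abelian_group ?A"
    proof (rule abelian_groupI)
      show "\<exists>g\<in>carrier ?A. g \<oplus>\<^bsub>?A\<^esub> f = \<zero>\<^bsub>?A\<^esub>" if "f \<in> carrier ?A" for f
        by (rule bexI[of _ "\<lambda>x. - f x"]) (use that in \<open>auto simp: group_algebra_def\<close>)
    qed (use add_closed in \<open>auto simp: group_algebra_def add.assoc add.commute\<close>)
    show "monoid ?A"
    proof (rule monoidI)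
      show "\<one>\<^bsub>?A\<^esub> \<in> carrier ?A" by (auto simp: group_algebra_def)
      show "\<one>\<^bsub>?A\<^esub> \<otimes>\<^bsub>?A\<^esub> f = f" if f: "f \<in> carrier ?A" for f
      proof
        fix x show "(\<one>\<^bsub>?A\<^esub> \<otimes>\<^bsub>?A\<^esub> f) x = f x"
        proof (cases "x \<in> carrier G")
          case True
          have "(\<one>\<^bsub>?A\<^esub> \<otimes>\<^bsub>?A\<^esub> f) x = (\<Sum>y\<in>{\<one>}. \<one>\<^bsub>?A\<^esub> y * f (inv y \<otimes> x))"
            by (rule mult_on) (use True in \<open>auto simp: group_algebra_def split: if_splits\<close>)
          then show ?thesis using True by (simp add: group_algebra_def)
        qed (use mult_out out f in auto)
      qed
      show "f \<otimes>\<^bsub>?A\<^esub> \<one>\<^bsub>?A\<^esub> = f" if f: "f \<in> carrier ?A" for f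
      proof
        fix x show "(f \<otimes>\<^bsub>?A\<^esub> \<one>\<^bsub>?A\<^esub>) x = f x"
        proof (cases "x \<in> carrier G")
          case True
          let ?B = "insert x {y. f y \<noteq> 0}"
          have "(f \<otimes>\<^bsub>?A\<^esub> \<one>\<^bsub>?A\<^esub>) x = (\<Sum>y\<in>?B. f y * \<one>\<^bsub>?A\<^esub> (inv y \<otimes> x))"
            by (rule mult_on) (use True fin f in auto)
          also have "\<dots> = (\<Sum>y\<in>?B. if y = x then f y else 0)"
          proof (rule sum.cong[OF refl])
            fix y assume "y \<in> ?B"
            then have y: "y \<in> carrier G" using True fin(2)[OF f] by auto
            have "inv y \<otimes> x = \<one> \<longleftrightarrow> y = x" using y True
              by (metis inv_closed inv_equality inv_inv l_inv)
            then show "f y * \<one>\<^bsub>?A\<^esub> (inv y \<otimes> x) = (if y = x then f y else 0)"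
              by (auto simp: group_algebra_def)
          qed
          also have "\<dots> = f x" using fin(1)[OF f] by (subst sum.delta) auto
          finally show ?thesis .
        qed (use mult_out out f in auto)
      qed
      show "f \<otimes>\<^bsub>?A\<^esub> g \<otimes>\<^bsub>?A\<^esub> h = f \<otimes>\<^bsub>?A\<^esub> (g \<otimes>\<^bsub>?A\<^esub> h)"
        if f: "f \<in> carrier ?A" and g: "g \<in> carrier ?A" and h: "h \<in> carrier ?A" for f g h
      proof
        fix x show "(f \<otimes>\<^bsub>?A\<^esub> g \<otimes>\<^bsub>?A\<^esub> h) x = (f \<otimes>\<^bsub>?A\<^esub> (g \<otimes>\<^bsub>?A\<^esub> h)) x"
        proof (cases "x \<in> carrier G")
          case True
          let ?F = "{x. f x \<noteq> 0}" and ?Gs = "{x. g x \<noteq> 0}"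
          let ?B = "(\<lambda>(y, z). y \<otimes> z) ` (?F \<times> ?Gs)"
          have finB: "finite ?B" using fin(1)[OF f] fin(1)[OF g] by simp
          have B: "?B \<subseteq> carrier G" using fin(2)[OF f] fin(2)[OF g] by auto
          have inner: "(\<Sum>z\<in>?B. g (inv y \<otimes> z) * h (inv z \<otimes> x)) = (g \<otimes>\<^bsub>?A\<^esub> h) (inv y \<otimes> x)"
            if "y \<in> ?F" for y
          proof -
            have y: "y \<in> carrier G" using that fin(2)[OF f] by auto
            have inj: "inj_on ((\<otimes>) y) ?Gs"
              using fin(2)[OF g] y by (intro inj_onI) (auto simp: subset_eq)
            have "(\<Sum>z\<in>?B. g (inv y \<otimes> z) * h (inv z \<otimes> x)) =
              (\<Sum>z\<in>(\<otimes>) y ` ?Gs. g (inv y \<otimes> z) * h (inv z \<otimes> x))"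
            proof (rule sum.mono_neutral_right[OF finB])
              show "(\<otimes>) y ` ?Gs \<subseteq> ?B" using that by force
              show "\<forall>z\<in>?B - (\<otimes>) y ` ?Gs. g (inv y \<otimes> z) * h (inv z \<otimes> x) = 0"
              proof
                fix z assume z: "z \<in> ?B - (\<otimes>) y ` ?Gs"
                then have "z \<in> carrier G" using B by auto
                then have "z = y \<otimes> (inv y \<otimes> z)" using y by (simp add: m_assoc[symmetric])
                then have "g (inv y \<otimes> z) = 0" using z by blast
                then show "g (inv y \<otimes> z) * h (inv z \<otimes> x) = 0" by simp
              qed
            qed
            also have "\<dots> = (\<Sum>w\<in>?Gs. g (inv y \<otimes> (y \<otimes> w)) * h (inv (y \<otimes> w) \<otimes> x))"
              by (simp add: sum.reindex[OF inj])
            also have "\<dots> = (\<Sum>w\<in>?Gs. g w * h (inv w \<otimes> (inv y \<otimes> x)))"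
            proof (rule sum.cong[OF refl])
              fix w assume "w \<in> ?Gs"
              then have w: "w \<in> carrier G" using fin(2)[OF g] by auto
              have "inv y \<otimes> (y \<otimes> w) = w" using y w by (simp add: m_assoc[symmetric])
              moreover have "inv (y \<otimes> w) \<otimes> x = inv w \<otimes> (inv y \<otimes> x)"
                using y w True by (simp add: inv_mult_group m_assoc)
              ultimately show "g (inv y \<otimes> (y \<otimes> w)) * h (inv (y \<otimes> w) \<otimes> x)
                = g w * h (inv w \<otimes> (inv y \<otimes> x))" by simp
            qed
            also have "\<dots> = (g \<otimes>\<^bsub>?A\<^esub> h) (inv y \<otimes> x)"
              by (rule mult_on[symmetric]) (use y True fin g in auto)
            finally show ?thesis .
          qed
          have "(f \<otimes>\<^bsub>?A\<^esub> g \<otimes>\<^bsub>?A\<^esub> h) x = (\<Sum>z\<in>?B. (f \<otimes>\<^bsub>?A\<^esub> g) z * h (inv z \<otimes> x))"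
            by (rule mult_on[OF True finB supp[OF f g]])
          also have "\<dots> = (\<Sum>z\<in>?B. \<Sum>y\<in>?F. f y * (g (inv y \<otimes> z) * h (inv z \<otimes> x)))"
          proof (rule sum.cong[OF refl])
            fix z assume "z \<in> ?B"
            then have "(f \<otimes>\<^bsub>?A\<^esub> g) z = (\<Sum>y\<in>?F. f y * g (inv y \<otimes> z))"
              by (intro mult_on) (use B fin f in auto)
            then show "(f \<otimes>\<^bsub>?A\<^esub> g) z * h (inv z \<otimes> x) =
              (\<Sum>y\<in>?F. f y * (g (inv y \<otimes> z) * h (inv z \<otimes> x)))"
              by (simp add: sum_distrib_right mult.assoc)
          qed
          also have "\<dots> = (\<Sum>y\<in>?F. f y * (\<Sum>z\<in>?B. g (inv y \<otimes> z) * h (inv z \<otimes> x)))"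
            by (subst sum.swap) (simp add: sum_distrib_left)
          also have "\<dots> = (\<Sum>y\<in>?F. f y * (g \<otimes>\<^bsub>?A\<^esub> h) (inv y \<otimes> x))"
            by (intro sum.cong refl arg_cong2[where f = "(*)"] inner)
          also have "\<dots> = (f \<otimes>\<^bsub>?A\<^esub> (g \<otimes>\<^bsub>?A\<^esub> h)) x"
            by (rule mult_on[symmetric]) (use True fin f in auto)
          finally show ?thesis .
        qed (use mult_out in auto)
      qed
    qed (use closed in auto)
    show "(f \<oplus>\<^bsub>?A\<^esub> g) \<otimes>\<^bsub>?A\<^esub> h = f \<otimes>\<^bsub>?A\<^esub> h \<oplus>\<^bsub>?A\<^esub> g \<otimes>\<^bsub>?A\<^esub> h"
      if f: "f \<in> carrier ?A" and g: "g \<in> carrier ?A" and h: "h \<in> carrier ?A" for f g h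
    proof
      fix x show "((f \<oplus>\<^bsub>?A\<^esub> g) \<otimes>\<^bsub>?A\<^esub> h) x = (f \<otimes>\<^bsub>?A\<^esub> h \<oplus>\<^bsub>?A\<^esub> g \<otimes>\<^bsub>?A\<^esub> h) x"
      proof (cases "x \<in> carrier G")
        case True
        let ?B = "{x. f x \<noteq> 0} \<union> {x. g x \<noteq> 0}"
        have finB: "finite ?B" using fin f g by simp
        have "(f \<otimes>\<^bsub>?A\<^esub> h) x = (\<Sum>y\<in>?B. f y * h (inv y \<otimes> x))"
          "(g \<otimes>\<^bsub>?A\<^esub> h) x = (\<Sum>y\<in>?B. g y * h (inv y \<otimes> x))"
          "((f \<oplus>\<^bsub>?A\<^esub> g) \<otimes>\<^bsub>?A\<^esub> h) x = (\<Sum>y\<in>?B. (f \<oplus>\<^bsub>?A\<^esub> g) y * h (inv y \<otimes> x))"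
          by (rule mult_on[OF True finB]; auto simp: add)+
        then show ?thesis by (simp add: add distrib_right sum.distrib)
      qed (simp add: add mult_out)
    qed
    show "h \<otimes>\<^bsub>?A\<^esub> (f \<oplus>\<^bsub>?A\<^esub> g) = h \<otimes>\<^bsub>?A\<^esub> f \<oplus>\<^bsub>?A\<^esub> h \<otimes>\<^bsub>?A\<^esub> g"
      if f: "f \<in> carrier ?A" and g: "g \<in> carrier ?A" and h: "h \<in> carrier ?A" for f g h
      by (rule ext) (simp add: group_algebra_def distrib_left sum.distrib)
  qed
qed


lemma (in left_module) smult_l_null [simp]:
  assumes x: "x \<in> carrier M" shows "\<zero> \<odot>\<^bsub>M\<^esub> x = \<zero>\<^bsub>M\<^esub>"
proof -
  have "\<zero> \<odot>\<^bsub>M\<^esub> x \<oplus>\<^bsub>M\<^esub> \<zero> \<odot>\<^bsub>M\<^esub> x = \<zero> \<odot>\<^bsub>M\<^esub> x"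
    using smult_l_distr[of \<zero> \<zero> x] x by simp
  then show ?thesis using x by (metis M.add.r_cancel_one' R.zero_closed smult_closed)
qed

lemma (in left_module) smult_r_null [simp]:
  assumes a: "a \<in> carrier R" shows "a \<odot>\<^bsub>M\<^esub> \<zero>\<^bsub>M\<^esub> = \<zero>\<^bsub>M\<^esub>"
proof -
  have "a \<odot>\<^bsub>M\<^esub> \<zero>\<^bsub>M\<^esub> \<oplus>\<^bsub>M\<^esub> a \<odot>\<^bsub>M\<^esub> \<zero>\<^bsub>M\<^esub> = a \<odot>\<^bsub>M\<^esub> \<zero>\<^bsub>M\<^esub>"
    using smult_r_distr[of a "\<zero>\<^bsub>M\<^esub>" "\<zero>\<^bsub>M\<^esub>"] a by simp
  then show ?thesis using a by (metis M.add.r_cancel_one' M.zero_closed smult_closed)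
qed

lemma (in left_module) minus_eq_smult:
  assumes x: "x \<in> carrier M" shows "\<ominus>\<^bsub>M\<^esub> x = (\<ominus> \<one>) \<odot>\<^bsub>M\<^esub> x"
proof -
  have "(\<ominus> \<one>) \<odot>\<^bsub>M\<^esub> x \<oplus>\<^bsub>M\<^esub> x = (\<ominus> \<one> \<oplus> \<one>) \<odot>\<^bsub>M\<^esub> x"
    using x by (simp add: smult_l_distr del: R.l_neg)
  also have "\<dots> = \<zero>\<^bsub>M\<^esub>" using x by (simp add: R.l_neg)
  finally show ?thesis using x by (intro M.minus_equality) auto
qed

lemma (in left_module) left_submodule_iff:
  "left_submodule R M L \<longleftrightarrow> L \<subseteq> carrier M \<and> \<zero>\<^bsub>M\<^esub> \<in> L \<and> (\<forall>x\<in>L. \<forall>y\<in>L. x \<oplus>\<^bsub>M\<^esub> y \<in> L) \<and>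
    (\<forall>a\<in>carrier R. \<forall>x\<in>L. a \<odot>\<^bsub>M\<^esub> x \<in> L)"  (is "?l \<longleftrightarrow> ?r")
proof
  assume ?l
  then have "additive_subgroup L M" and *: "\<forall>a\<in>carrier R. \<forall>x\<in>L. a \<odot>\<^bsub>M\<^esub> x \<in> L"
    by (auto simp: left_submodule_def)
  then interpret additive_subgroup L M by simp
  show ?r using * a_subset a_closed zero_closed by auto
next
  assume r: ?r
  have "subgroup L (add_monoid M)"
  proof
    show "inv\<^bsub>add_monoid M\<^esub> x \<in> L" if "x \<in> L" for x
      using r that minus_eq_smult[of x] by (auto simp: a_inv_def subset_eq)
  qed (use r in auto)
  then show ?l using r by (simp add: left_submodule_def additive_subgroup_def)
qed

lemma left_module_homD:
  assumes "f \<in> left_module_hom R M N"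
  shows "x \<in> carrier M \<Longrightarrow> f x \<in> carrier N"
    and "x \<in> carrier M \<Longrightarrow> y \<in> carrier M \<Longrightarrow> f (x \<oplus>\<^bsub>M\<^esub> y) = f x \<oplus>\<^bsub>N\<^esub> f y"
    and "a \<in> carrier R \<Longrightarrow> x \<in> carrier M \<Longrightarrow> f (a \<odot>\<^bsub>M\<^esub> x) = a \<odot>\<^bsub>N\<^esub> f x"
  using assms by (auto simp: left_module_hom_def)

lemma left_module_hom_zero:
  assumes "left_module R M" "left_module R N" "f \<in> left_module_hom R M N"
  shows "f \<zero>\<^bsub>M\<^esub> = \<zero>\<^bsub>N\<^esub>"
proof -
  interpret M: left_module R M by fact
  interpret N: left_module R N by fact
  have "f (\<zero>\<^bsub>R\<^esub> \<odot>\<^bsub>M\<^esub> \<zero>\<^bsub>M\<^esub>) = \<zero>\<^bsub>R\<^esub> \<odot>\<^bsub>N\<^esub> f \<zero>\<^bsub>M\<^esub>"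
    by (rule left_module_homD(3)[OF assms(3)]) auto
  then show ?thesis using left_module_homD(1)[OF assms(3)] by simp
qed

lemma left_module_hom_comp:
  assumes "f \<in> left_module_hom R L M" "g \<in> left_module_hom R M N"
  shows "(\<lambda>x. g (f x)) \<in> left_module_hom R L N"
  using assms by (auto simp: left_module_hom_def Pi_iff)

lemma left_module_hom_inv:
  assumes "left_module R M" "f \<in> left_module_hom R M N" "bij_betw f (carrier M) (carrier N)"
  shows "inv_into (carrier M) f \<in> left_module_hom R N M"
proof -
  interpret left_module R M by fact
  let ?g = "inv_into (carrier M) f"
  have g: "?g y \<in> carrier M" "f (?g y) = y" if "y \<in> carrier N" for y
    using that assms(3) by (auto simp: bij_betw_def inv_into_into f_inv_into_f)
  have eq: "?g (f x) = x" if "x \<in> carrier M" for x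
    using that assms(3) by (auto simp: bij_betw_def)
  have "?g (x \<oplus>\<^bsub>N\<^esub> y) = ?g x \<oplus>\<^bsub>M\<^esub> ?g y" if "x \<in> carrier N" "y \<in> carrier N" for x y
    using eq[of "?g x \<oplus>\<^bsub>M\<^esub> ?g y"] left_module_homD(2)[OF assms(2), of "?g x" "?g y"] g that by simp
  moreover have "?g (a \<odot>\<^bsub>N\<^esub> x) = a \<odot>\<^bsub>M\<^esub> ?g x" if "a \<in> carrier R" "x \<in> carrier N" for a x
    using eq[of "a \<odot>\<^bsub>M\<^esub> ?g x"] left_module_homD(3)[OF assms(2), of a "?g x"] g that by simp
  ultimately show ?thesis using g by (auto simp: left_module_hom_def)
qed

lemma left_submodule_image:
  assumes "left_module R M" "left_module R N" "f \<in> left_module_hom R M N" "left_submodule R M L"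
  shows "left_submodule R N (f ` L)"
proof -
  interpret M: left_module R M by fact
  interpret N: left_module R N by fact
  have L: "L \<subseteq> carrier M" "\<zero>\<^bsub>M\<^esub> \<in> L" "\<And>x y. x \<in> L \<Longrightarrow> y \<in> L \<Longrightarrow> x \<oplus>\<^bsub>M\<^esub> y \<in> L"
    "\<And>a x. a \<in> carrier R \<Longrightarrow> x \<in> L \<Longrightarrow> a \<odot>\<^bsub>M\<^esub> x \<in> L"
    using assms(4) by (auto simp: M.left_submodule_iff)
  note h = left_module_homD[OF assms(3)]
  show ?thesis unfolding N.left_submodule_iff
  proof (intro conjI ballI)
    show "f ` L \<subseteq> carrier N" using L(1) h(1) by auto
    show "\<zero>\<^bsub>N\<^esub> \<in> f ` L" using left_module_hom_zero[OF assms(1-3)] L(2) by (metis imageI)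
    show "x \<oplus>\<^bsub>N\<^esub> y \<in> f ` L" if xy: "x \<in> f ` L" "y \<in> f ` L" for x y
    proof -
      obtain u v where uv: "x = f u" "y = f v" "u \<in> L" "v \<in> L" using xy by auto
      then have "x \<oplus>\<^bsub>N\<^esub> y = f (u \<oplus>\<^bsub>M\<^esub> v)" using h(2)[of u v] L(1) by (simp add: subset_iff)
      then show ?thesis using uv L(3) by auto
    qed
    show "a \<odot>\<^bsub>N\<^esub> x \<in> f ` L" if ax: "a \<in> carrier R" "x \<in> f ` L" for a x
    proof -
      obtain u where u: "x = f u" "u \<in> L" using ax by auto
      then have "a \<odot>\<^bsub>N\<^esub> x = f (a \<odot>\<^bsub>M\<^esub> u)" using h(3)[of a u] ax L(1) by (simp add: subset_iff)
      then show ?thesis using u ax L(4) by auto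
    qed
  qed
qed

lemma simple_module_iso:
  assumes "simple_module R M" "left_module R N" "f \<in> left_module_hom R M N"
    "bij_betw f (carrier M) (carrier N)"
  shows "simple_module R N"
proof -
  have M: "left_module R M" using assms(1) by (simp add: simple_module_def)
  let ?g = "inv_into (carrier M) f"
  have g: "?g \<in> left_module_hom R N M" by (rule left_module_hom_inv[OF M assms(3,4)])
  have f0: "f \<zero>\<^bsub>M\<^esub> = \<zero>\<^bsub>N\<^esub>" by (rule left_module_hom_zero[OF M assms(2,3)])
  interpret M: left_module R M by fact
  interpret N: left_module R N by fact
  have "carrier N \<noteq> {\<zero>\<^bsub>N\<^esub>}"
  proof
    assume "carrier N = {\<zero>\<^bsub>N\<^esub>}"
    then have "f ` carrier M = f ` {\<zero>\<^bsub>M\<^esub>}" using assms(4) f0 by (simp add: bij_betw_def)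
    then have "carrier M = {\<zero>\<^bsub>M\<^esub>}"
      using assms(4) by (subst (asm) inj_on_image_eq_iff[of f "carrier M"]) (auto simp: bij_betw_def)
    then show False using assms(1) by (simp add: simple_module_def)
  qed
  moreover have "L = {\<zero>\<^bsub>N\<^esub>} \<or> L = carrier N" if L: "left_submodule R N L" for L
  proof -
    have "L \<subseteq> carrier N" using L by (simp add: N.left_submodule_iff)
    then have eq: "f ` ?g ` L = L"
      using assms(4) by (simp add: bij_betw_def image_inv_into_cancel)
    have "left_submodule R M (?g ` L)" by (rule left_submodule_image[OF assms(2) M g L])
    then have "?g ` L = {\<zero>\<^bsub>M\<^esub>} \<or> ?g ` L = carrier M"
      using assms(1) by (simp add: simple_module_def)
    then show ?thesis using eq f0 assms(4) by (auto simp: bij_betw_def)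
  qed
  ultimately show ?thesis using assms(2) by (simp add: simple_module_def)
qed

definition free_module :: "('a, 'r) ring_scheme \<Rightarrow> 'i set \<Rightarrow> ('a, 'i \<Rightarrow> 'a) module"
  where "free_module R I =
    \<lparr>carrier = {c. (\<forall>i. c i \<in> carrier R) \<and> finite {i. c i \<noteq> \<zero>\<^bsub>R\<^esub>} \<and> {i. c i \<noteq> \<zero>\<^bsub>R\<^esub>} \<subseteq> I},
     monoid.mult = undefined, monoid.one = undefined, ring.zero = (\<lambda>i. \<zero>\<^bsub>R\<^esub>),
     ring.add = (\<lambda>c d i. c i \<oplus>\<^bsub>R\<^esub> d i), module.smult = (\<lambda>a c i. a \<otimes>\<^bsub>R\<^esub> c i)\<rparr>"

lemma free_module_carrierI:
  assumes "\<And>i. c i \<in> carrier R" "finite B" "{i. c i \<noteq> \<zero>\<^bsub>R\<^esub>} \<subseteq> B" "B \<subseteq> I"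
  shows "c \<in> carrier (free_module R I)"
  using assms finite_subset[of "{i. c i \<noteq> \<zero>\<^bsub>R\<^esub>}" B] by (simp add: free_module_def subset_trans)

lemma free_module_left_module:
  assumes "ring R"
  shows "left_module R (free_module R I)"
proof -
  interpret ring R by fact
  let ?F = "free_module R I"
  let ?s = "\<lambda>c. {i. c i \<noteq> \<zero>\<^bsub>R\<^esub>}"
  have F: "c i \<in> carrier R" "finite (?s c)" "?s c \<subseteq> I" if "c \<in> carrier ?F" for c i
    using that by (auto simp: free_module_def)
  show ?thesis
  proof (intro left_module.intro left_module_axioms.intro)
    show "ring R" by fact
    show "abelian_group ?F"
    proof (rule abelian_groupI)
      show "c \<oplus>\<^bsub>?F\<^esub> d \<in> carrier ?F" if "c \<in> carrier ?F" "d \<in> carrier ?F" for c d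
        by (rule free_module_carrierI[of _ _ "?s c \<union> ?s d"])
          (use F[OF that(1)] F[OF that(2)] in \<open>auto simp: free_module_def\<close>)
      show "\<zero>\<^bsub>?F\<^esub> \<in> carrier ?F" by (simp add: free_module_def)
      show "\<exists>d\<in>carrier ?F. d \<oplus>\<^bsub>?F\<^esub> c = \<zero>\<^bsub>?F\<^esub>" if c: "c \<in> carrier ?F" for c
      proof
        show "(\<lambda>i. \<ominus>\<^bsub>R\<^esub> c i) \<in> carrier ?F"
          by (rule free_module_carrierI[of _ _ "?s c"]) (use F[OF c] in auto)
        show "(\<lambda>i. \<ominus>\<^bsub>R\<^esub> c i) \<oplus>\<^bsub>?F\<^esub> c = \<zero>\<^bsub>?F\<^esub>"
          using F(1)[OF c] by (simp add: free_module_def l_neg)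
      qed
      show "c \<oplus>\<^bsub>?F\<^esub> d \<oplus>\<^bsub>?F\<^esub> e = c \<oplus>\<^bsub>?F\<^esub> (d \<oplus>\<^bsub>?F\<^esub> e)"
        if "c \<in> carrier ?F" "d \<in> carrier ?F" "e \<in> carrier ?F" for c d e
        using F(1)[OF that(1)] F(1)[OF that(2)] F(1)[OF that(3)]
        by (simp add: free_module_def a_assoc)
      show "c \<oplus>\<^bsub>?F\<^esub> d = d \<oplus>\<^bsub>?F\<^esub> c" if "c \<in> carrier ?F" "d \<in> carrier ?F" for c d
        using F(1)[OF that(1)] F(1)[OF that(2)] by (simp add: free_module_def a_comm)
      show "\<zero>\<^bsub>?F\<^esub> \<oplus>\<^bsub>?F\<^esub> c = c" if "c \<in> carrier ?F" for c
        using F(1)[OF that] by (simp add: free_module_def)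
    qed
    show "a \<odot>\<^bsub>?F\<^esub> c \<in> carrier ?F" if "a \<in> carrier R" "c \<in> carrier ?F" for a c
      by (rule free_module_carrierI[of _ _ "?s c"])
        (use that(1) F[OF that(2)] in \<open>auto simp: free_module_def\<close>)
  qed (auto simp: free_module_def l_distr r_distr m_assoc)
qed

lemma (in left_module) finsum_smult:
  assumes "a \<in> carrier R" "finite B" "m \<in> B \<rightarrow> carrier M"
  shows "a \<odot>\<^bsub>M\<^esub> finsum M m B = finsum M (\<lambda>i. a \<odot>\<^bsub>M\<^esub> m i) B"
  using assms(2,3)
proof (induction B rule: finite_induct)
  case (insert i B)
  then show ?case using assms(1) by (simp add: Pi_iff smult_r_distr)
qed (use assms(1) in simp)

lemma hom_finsum:
  assumes "left_module R M" "left_module R N" "f \<in> left_module_hom R M N"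
    and "finite B" "m \<in> B \<rightarrow> carrier M"
  shows "f (finsum M m B) = finsum N (\<lambda>i. f (m i)) B"
proof -
  interpret M: left_module R M by fact
  interpret N: left_module R N by fact
  note h = left_module_homD[OF assms(3)]
  show ?thesis using assms(4,5)
  proof (induction B rule: finite_induct)
    case empty
    show ?case using left_module_hom_zero[OF assms(1-3)] by simp
  next
    case (insert i B)
    then show ?case using h(1,2) by (simp add: Pi_iff M.M.finsum_closed)
  qed
qed

definition free_eval ::
    "('a, 'r) ring_scheme \<Rightarrow> ('a, 'm, 's) module_scheme \<Rightarrow> ('i \<Rightarrow> 'm) \<Rightarrow> ('i \<Rightarrow> 'a) \<Rightarrow> 'm"
  where "free_eval R M m c = finsum M (\<lambda>i. c i \<odot>\<^bsub>M\<^esub> m i) {i. c i \<noteq> \<zero>\<^bsub>R\<^esub>}"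

lemma (in left_module) free_eval_on:
  assumes "finite B" "{i. c i \<noteq> \<zero>} \<subseteq> B" "\<And>i. i \<in> B \<Longrightarrow> c i \<in> carrier R" "\<And>i. i \<in> B \<Longrightarrow> m i \<in> carrier M"
  shows "free_eval R M m c = finsum M (\<lambda>i. c i \<odot>\<^bsub>M\<^esub> m i) B"
  unfolding free_eval_def
proof (rule M.add.finprod_mono_neutral_cong_left)
  show "c i \<odot>\<^bsub>M\<^esub> m i = \<zero>\<^bsub>M\<^esub>" if "i \<in> B - {i. c i \<noteq> \<zero>}" for i
    using that assms(4) by simp
qed (use assms in \<open>auto simp: Pi_iff\<close>)

lemma (in left_module) free_eval_hom:
  assumes m: "m \<in> I \<rightarrow> carrier M"
  shows "free_eval R M m \<in> left_module_hom R (free_module R I) M"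
proof -
  let ?F = "free_module R I"
  let ?s = "\<lambda>c. {i. c i \<noteq> \<zero>}"
  have F: "c i \<in> carrier R" "finite (?s c)" "?s c \<subseteq> I" if "c \<in> carrier ?F" for c i
    using that by (auto simp: free_module_def)
  have m': "m i \<in> carrier M" if "i \<in> ?s c" "c \<in> carrier ?F" for i c
    using F(3)[OF that(2)] that(1) m by auto
  have "free_eval R M m c \<in> carrier M" if c: "c \<in> carrier ?F" for c
    unfolding free_eval_def using F(1)[OF c] m'[OF _ c] by (intro M.finsum_closed) auto
  moreover have "free_eval R M m (c \<oplus>\<^bsub>?F\<^esub> d) = free_eval R M m c \<oplus>\<^bsub>M\<^esub> free_eval R M m d"
    if c: "c \<in> carrier ?F" and d: "d \<in> carrier ?F" for c d
  proof -
    let ?B = "?s c \<union> ?s d"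
    have B: "finite ?B" "\<And>i. i \<in> ?B \<Longrightarrow> m i \<in> carrier M" using F c d m' by auto
    have "free_eval R M m c = finsum M (\<lambda>i. c i \<odot>\<^bsub>M\<^esub> m i) ?B"
      "free_eval R M m d = finsum M (\<lambda>i. d i \<odot>\<^bsub>M\<^esub> m i) ?B"
      by (rule free_eval_on; use B F(1)[OF c] F(1)[OF d] in auto)+
    moreover have "free_eval R M m (c \<oplus>\<^bsub>?F\<^esub> d) = finsum M (\<lambda>i. (c \<oplus>\<^bsub>?F\<^esub> d) i \<odot>\<^bsub>M\<^esub> m i) ?B"
      by (rule free_eval_on) (use B F(1)[OF c] F(1)[OF d] in \<open>auto simp: free_module_def\<close>)
    moreover have "\<dots> = finsum M (\<lambda>i. c i \<odot>\<^bsub>M\<^esub> m i \<oplus>\<^bsub>M\<^esub> d i \<odot>\<^bsub>M\<^esub> m i) ?B"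
      by (rule M.finsum_cong')
        (use B F(1)[OF c] F(1)[OF d] in \<open>auto simp: free_module_def smult_l_distr\<close>)
    moreover have "\<dots> = finsum M (\<lambda>i. c i \<odot>\<^bsub>M\<^esub> m i) ?B \<oplus>\<^bsub>M\<^esub> finsum M (\<lambda>i. d i \<odot>\<^bsub>M\<^esub> m i) ?B"
      by (rule M.finsum_addf) (use B F(1)[OF c] F(1)[OF d] in auto)
    ultimately show ?thesis by simp
  qed
  moreover have "free_eval R M m (a \<odot>\<^bsub>?F\<^esub> c) = a \<odot>\<^bsub>M\<^esub> free_eval R M m c"
    if a: "a \<in> carrier R" and c: "c \<in> carrier ?F" for a c
  proof -
    have "free_eval R M m (a \<odot>\<^bsub>?F\<^esub> c) = finsum M (\<lambda>i. (a \<odot>\<^bsub>?F\<^esub> c) i \<odot>\<^bsub>M\<^esub> m i) (?s c)"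
      by (rule free_eval_on) (use a F(1,2)[OF c] m'[OF _ c] in \<open>auto simp: free_module_def\<close>)
    also have "\<dots> = finsum M (\<lambda>i. a \<odot>\<^bsub>M\<^esub> (c i \<odot>\<^bsub>M\<^esub> m i)) (?s c)"
      by (rule M.finsum_cong')
        (use a F(1)[OF c] m'[OF _ c] in \<open>auto simp: free_module_def smult_assoc\<close>)
    also have "\<dots> = a \<odot>\<^bsub>M\<^esub> free_eval R M m c" unfolding free_eval_def
      by (rule finsum_smult[symmetric]) (use a F(1,2)[OF c] m'[OF _ c] in auto)
    finally show ?thesis .
  qed
  ultimately show ?thesis by (auto simp: left_module_hom_def)
qed

lemma projective_module_lift:
  fixes P :: "('a, 'p) module" and M :: "('a, 'm) module" and N :: "('a, 'n) module"
  assumes P: "projective_module R P" and M: "left_module R M" and N: "left_module R N"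
    and g: "g \<in> left_module_hom R M N" "g ` carrier M = carrier N" and f: "f \<in> left_module_hom R P N"
  shows "\<exists>h\<in>left_module_hom R P M. \<forall>x\<in>carrier P. g (h x) = f x"
proof -
  have P': "left_module R P" using P by (simp add: projective_module_def)
  interpret P: left_module R P by fact
  interpret M: left_module R M by fact
  interpret N: left_module R N by fact
  let ?F = "free_module R (carrier P)"
  let ?s = "\<lambda>c. {i. c i \<noteq> \<zero>\<^bsub>R\<^esub>}"
  have F: "c i \<in> carrier R" "finite (?s c)" "?s c \<subseteq> carrier P" if "c \<in> carrier ?F" for c i
    using that by (auto simp: free_module_def)
  have Fm: "left_module R ?F" by (rule free_module_left_module) (rule P.R.ring_axioms)
  let ?e = "free_eval R P (\<lambda>p. p)"
  have e: "?e \<in> left_module_hom R ?F P" by (rule P.free_eval_hom) auto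
  have surj: "?e ` carrier ?F = carrier P"
  proof
    show "?e ` carrier ?F \<subseteq> carrier P" using left_module_homD(1)[OF e] by auto
    show "carrier P \<subseteq> ?e ` carrier ?F"
    proof
      fix p assume p: "p \<in> carrier P"
      let ?d = "\<lambda>q. if q = p then \<one>\<^bsub>R\<^esub> else \<zero>\<^bsub>R\<^esub>"
      have "?d \<in> carrier ?F" by (rule free_module_carrierI[of _ _ "{p}"]) (use p in auto)
      moreover have "?e ?d = finsum P (\<lambda>q. ?d q \<odot>\<^bsub>P\<^esub> q) {p}"
        by (rule P.free_eval_on) (use p in auto)
      then have "?e ?d = p" using p by simp
      ultimately show "p \<in> ?e ` carrier ?F" by force
    qed
  qed
  have idP: "(\<lambda>x. x) \<in> left_module_hom R P P" by (auto simp: left_module_hom_def)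
  have "\<exists>h\<in>left_module_hom R P ?F. \<forall>x\<in>carrier P. ?e (h x) = x"
    by (rule P[unfolded projective_module_def, THEN conjunct2, rule_format, OF e idP])
      (use Fm P' surj in simp)
  then obtain s where s: "s \<in> left_module_hom R P ?F" "\<forall>x\<in>carrier P. ?e (s x) = x"
    by (elim bexE)
  define m where "m p = (SOME y. y \<in> carrier M \<and> g y = f p)" for p
  have m: "m p \<in> carrier M \<and> g (m p) = f p" if "p \<in> carrier P" for p
  proof -
    have "f p \<in> g ` carrier M" using left_module_homD(1)[OF f that] g(2) by simp
    then show ?thesis unfolding m_def by (intro someI_ex[where P = "\<lambda>y. y \<in> carrier M \<and> g y = f p"]) auto
  qed
  have e': "free_eval R M m \<in> left_module_hom R ?F M"
    by (rule M.free_eval_hom) (use m in auto)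
  have eq: "g (free_eval R M m c) = f (?e c)" if c: "c \<in> carrier ?F" for c
  proof -
    have *: "c i \<in> carrier R" "i \<in> carrier P" if "i \<in> ?s c" for i using F[OF c] that by auto
    have "g (free_eval R M m c) = finsum N (\<lambda>i. g (c i \<odot>\<^bsub>M\<^esub> m i)) (?s c)"
      unfolding free_eval_def by (rule hom_finsum[OF M N g(1) F(2)[OF c]]) (use * m in auto)
    also have "\<dots> = finsum N (\<lambda>i. f (c i \<odot>\<^bsub>P\<^esub> i)) (?s c)"
      by (rule N.M.finsum_cong')
        (use * m left_module_homD[OF f] left_module_homD(3)[OF g(1)] in auto)
    also have "\<dots> = f (?e c)"
      unfolding free_eval_def by (rule hom_finsum[OF P' N f F(2)[OF c], symmetric]) (use * in auto)
    finally show ?thesis .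
  qed
  show ?thesis
  proof (rule bexI[OF _ left_module_hom_comp[OF s(1) e']])
    show "\<forall>x\<in>carrier P. g (free_eval R M m (s x)) = f x"
      using eq left_module_homD(1)[OF s(1)] s(2) by auto
  qed
qed

lemma projective_module_iso:
  fixes P :: "('a, 'p) module" and Q :: "('a, 'q) module"
  assumes P: "projective_module R P" and Q: "left_module R Q"
    and f: "f \<in> left_module_hom R P Q" "bij_betw f (carrier P) (carrier Q)"
  shows "projective_module R Q"
  unfolding projective_module_def
proof (intro conjI allI ballI impI)
  show "left_module R Q" by fact
  fix M :: "('a, 'q \<Rightarrow> 'a) module" and N :: "('a, 'q) module" and g u
  assume g: "g \<in> left_module_hom R M N" and u: "u \<in> left_module_hom R Q N"
    and *: "left_module R M \<and> left_module R N \<and> g ` carrier M = carrier N"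
  have P': "left_module R P" using P by (simp add: projective_module_def)
  let ?v = "inv_into (carrier P) f"
  have v: "?v \<in> left_module_hom R Q P" by (rule left_module_hom_inv[OF P' f])
  obtain h where h: "h \<in> left_module_hom R P M" "\<forall>x\<in>carrier P. g (h x) = u (f x)"
    using projective_module_lift[OF P _ _ g _ left_module_hom_comp[OF f(1) u]] * by blast
  show "\<exists>h\<in>left_module_hom R Q M. \<forall>x\<in>carrier Q. g (h x) = u x"
  proof (rule bexI[OF _ left_module_hom_comp[OF v h(1)]])
    show "\<forall>x\<in>carrier Q. g (h (?v x)) = u x"
      using h(2) left_module_homD(1)[OF v] f(2) by (auto simp: bij_betw_def f_inv_into_f)
  qed
qed

lemma cyclic_module_copy:
  fixes M :: "('a, 'm) module"
  assumes "left_module R M" "x \<in> carrier M" "carrier M = (\<lambda>a. a \<odot>\<^bsub>M\<^esub> x) ` carrier R"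
  shows "\<exists>(N :: ('a, 'a) module) f. left_module R N \<and> f \<in> left_module_hom R M N \<and>
    bij_betw f (carrier M) (carrier N)"
proof -
  interpret left_module R M by fact
  let ?o = "\<lambda>a. a \<odot>\<^bsub>M\<^esub> x"
  define f where "f = inv_into (carrier R) ?o"
  have fR: "f y \<in> carrier R" "?o (f y) = y" if "y \<in> carrier M" for y
    using that assms(3) inv_into_into[of y ?o "carrier R"] f_inv_into_f[of y ?o "carrier R"]
    unfolding f_def by simp_all
  define N :: "('a, 'a) module" where "N = \<lparr>carrier = f ` carrier M, monoid.mult = undefined,
    monoid.one = undefined, ring.zero = f \<zero>\<^bsub>M\<^esub>, ring.add = (\<lambda>u v. f (?o u \<oplus>\<^bsub>M\<^esub> ?o v)),
    module.smult = (\<lambda>a u. f (a \<odot>\<^bsub>M\<^esub> ?o u))\<rparr>"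
  have N: "left_module R N"
  proof (intro left_module.intro left_module_axioms.intro)
    show "ring R" by (rule R.ring_axioms)
    show "abelian_group N"
    proof (rule abelian_groupI)
      show "\<exists>v\<in>carrier N. v \<oplus>\<^bsub>N\<^esub> u = \<zero>\<^bsub>N\<^esub>" if u: "u \<in> carrier N" for u
      proof (rule bexI[of _ "f (\<ominus>\<^bsub>M\<^esub> (?o u))"])
        show "f (\<ominus>\<^bsub>M\<^esub> ?o u) \<oplus>\<^bsub>N\<^esub> u = \<zero>\<^bsub>N\<^esub>" using u fR by (auto simp: N_def M.l_neg)
        show "f (\<ominus>\<^bsub>M\<^esub> ?o u) \<in> carrier N" using u fR by (auto simp: N_def)
      qed
    qed (auto simp: N_def fR M.a_ac)
  qed (auto simp: N_def fR smult_l_distr smult_r_distr smult_assoc)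
  moreover have "f \<in> left_module_hom R M N" by (auto simp: left_module_hom_def N_def fR)
  moreover have "bij_betw f (carrier M) (carrier N)"
    using inj_on_inverseI[of "carrier M" ?o f] fR(2) by (simp add: bij_betw_def N_def)
  ultimately show ?thesis by blast
qed

lemma (in left_module) cyclic_submodule:
  assumes x: "x \<in> carrier M"
  shows "left_submodule R M ((\<lambda>a. a \<odot>\<^bsub>M\<^esub> x) ` carrier R)"
  unfolding left_submodule_iff
proof (intro conjI ballI)
  let ?L = "(\<lambda>a. a \<odot>\<^bsub>M\<^esub> x) ` carrier R"
  show "?L \<subseteq> carrier M" using x by auto
  show "\<zero>\<^bsub>M\<^esub> \<in> ?L" using x by (metis R.zero_closed image_eqI smult_l_null)
  show "u \<oplus>\<^bsub>M\<^esub> v \<in> ?L" if uv: "u \<in> ?L" "v \<in> ?L" for u v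
  proof -
    obtain a where a: "u = a \<odot>\<^bsub>M\<^esub> x" "a \<in> carrier R" using uv(1) unfolding image_iff by blast
    obtain b where b: "v = b \<odot>\<^bsub>M\<^esub> x" "b \<in> carrier R" using uv(2) unfolding image_iff by blast
    have "u \<oplus>\<^bsub>M\<^esub> v = (a \<oplus> b) \<odot>\<^bsub>M\<^esub> x" using smult_l_distr[OF a(2) b(2) x] a(1) b(1) by simp
    then show ?thesis using R.a_closed[OF a(2) b(2)] by (rule image_eqI)
  qed
  show "a \<odot>\<^bsub>M\<^esub> u \<in> ?L" if uv: "a \<in> carrier R" "u \<in> ?L" for a u
  proof -
    obtain b where b: "u = b \<odot>\<^bsub>M\<^esub> x" "b \<in> carrier R" using uv(2) unfolding image_iff by blast
    have "a \<odot>\<^bsub>M\<^esub> u = (a \<otimes> b) \<odot>\<^bsub>M\<^esub> x" using smult_assoc[OF uv(1) b(2) x] b(1) by simp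
    then show ?thesis using R.m_closed[OF uv(1) b(2)] by (rule image_eqI)
  qed
qed

text \<open>Every simple module, over any type, is isomorphic to one on the element type of the ring.\<close>

lemma simple_module_copy:
  fixes S :: "('a, 'm) module"
  assumes S: "simple_module R S"
  shows "\<exists>T :: ('a, 'a) module. simple_module R T \<and> left_module_iso R S T"
proof -
  have S': "left_module R S" using S by (simp add: simple_module_def)
  interpret left_module R S by fact
  obtain x where x: "x \<in> carrier S" "x \<noteq> \<zero>\<^bsub>S\<^esub>" using S by (auto simp: simple_module_def)
  have "\<one>\<^bsub>R\<^esub> \<odot>\<^bsub>S\<^esub> x \<in> (\<lambda>a. a \<odot>\<^bsub>S\<^esub> x) ` carrier R" by blast
  then have "(\<lambda>a. a \<odot>\<^bsub>S\<^esub> x) ` carrier R \<noteq> {\<zero>\<^bsub>S\<^esub>}" using x by auto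
  then have eq: "carrier S = (\<lambda>a. a \<odot>\<^bsub>S\<^esub> x) ` carrier R"
    using S cyclic_submodule[OF x(1)] unfolding simple_module_def by blast
  obtain T :: "('a, 'a) module" and f where T: "left_module R T" "f \<in> left_module_hom R S T"
    "bij_betw f (carrier S) (carrier T)"
    using cyclic_module_copy[OF S' x(1) eq] by (elim exE conjE)
  have "left_module_iso R S T" unfolding left_module_iso_def using T(2,3) by blast
  then show ?thesis using simple_module_iso[OF S T] by blast
qed

text \<open>Every projective cover of a simple module, over any type, is isomorphic to one on the element
  type of the ring.\<close>

lemma projective_cover_copy:
  fixes P :: "('a, 'm) module" and T :: "('a, 'n) module"
  assumes T: "simple_module R T" and P: "projective_cover R T P f"
  shows "\<exists>(Q :: ('a, 'a) module) g. projective_cover R T Q g \<and> left_module_iso R P Q"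
proof -
  have T': "left_module R T" using T by (simp add: simple_module_def)
  have pP: "projective_module R P" and f: "f \<in> left_module_hom R P T" "f ` carrier P = carrier T"
    and ess: "\<And>L. left_submodule R P L \<Longrightarrow> f ` L = carrier T \<Longrightarrow> L = carrier P"
    using P by (auto simp: projective_cover_def essential_epi_def)
  have P': "left_module R P" using pP by (simp add: projective_module_def)
  interpret T: left_module R T by fact
  interpret P: left_module R P by fact
  obtain t where t: "t \<in> carrier T" "t \<noteq> \<zero>\<^bsub>T\<^esub>" using T by (auto simp: simple_module_def)
  then obtain x where x: "x \<in> carrier P" "f x = t" using f(2) by (metis imageE)
  let ?L = "(\<lambda>a. a \<odot>\<^bsub>P\<^esub> x) ` carrier R"
  have L: "left_submodule R P ?L" by (rule P.cyclic_submodule[OF x(1)])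
  have "\<one>\<^bsub>R\<^esub> \<odot>\<^bsub>P\<^esub> x \<in> ?L" by blast
  then have "t \<in> f ` ?L" using x by auto
  then have "f ` ?L \<noteq> {\<zero>\<^bsub>T\<^esub>}" using t(2) by blast
  then have "f ` ?L = carrier T"
    using T left_submodule_image[OF P' T' f(1) L] unfolding simple_module_def by blast
  then have eq: "carrier P = ?L" using ess[OF L] by simp
  obtain Q :: "('a, 'a) module" and u where Q: "left_module R Q"
    and u: "u \<in> left_module_hom R P Q" "bij_betw u (carrier P) (carrier Q)"
    using cyclic_module_copy[OF P' x(1) eq] by (elim exE conjE)
  let ?v = "inv_into (carrier P) u"
  have v: "?v \<in> left_module_hom R Q P" by (rule left_module_hom_inv[OF P' u])
  have vQ: "?v ` carrier Q = carrier P" using u(2) by (metis bij_betw_def bij_betw_inv_into)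
  have "essential_epi R Q T (\<lambda>y. f (?v y))"
    unfolding essential_epi_def
  proof (intro conjI allI impI)
    show "(\<lambda>y. f (?v y)) \<in> left_module_hom R Q T" by (rule left_module_hom_comp[OF v f(1)])
    show "(\<lambda>y. f (?v y)) ` carrier Q = carrier T" using vQ f(2) by (metis image_image)
    fix K assume K: "left_submodule R Q K \<and> (\<lambda>y. f (?v y)) ` K = carrier T"
    interpret Q: left_module R Q by fact
    have "?v ` K = carrier P"
    proof (rule ess)
      show "left_submodule R P (?v ` K)" by (rule left_submodule_image[OF Q P' v]) (use K in simp)
      show "f ` ?v ` K = carrier T" using K by (simp add: image_image)
    qed
    moreover have "K \<subseteq> carrier Q" using K by (simp add: Q.left_submodule_iff)
    ultimately show "K = carrier Q"
      using u(2) by (metis bij_betw_def image_inv_into_cancel)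
  qed
  moreover have "projective_module R Q" by (rule projective_module_iso[OF pP Q u])
  ultimately have "projective_cover R T Q (\<lambda>y. f (?v y))" by (simp add: projective_cover_def)
  moreover have "left_module_iso R P Q"
    unfolding left_module_iso_def using u by blast
  ultimately show ?thesis by blast
qed

end

theory Submission
  imports Defs "HOL-Library.Function_Algebras"
begin

text \<open>Let \<open>A\<close> be the group algebra. In characteristic two it is commutative and every element of the
  Klein four-group squares to the identity, so the Frobenius map gives \<open>a\<^sup>2 = \<epsilon>(a)\<^sup>2 \<cdot> 1\<close> for all \<open>a\<close>,
  where \<open>\<epsilon>\<close> is the augmentation (lemma \<open>klein_square\<close>). Hence \<open>a\<close> is a unit if \<open>\<epsilon>(a) \<noteq> 0\<close> and
  \<open>a\<^sup>2 = 0\<close> otherwise: \<open>A\<close> is local with nil maximal ideal \<open>ker \<epsilon>\<close> and residue field \<open>k\<close>.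

  For any commutative ring of this kind a non-unit annihilates every simple module, because its kernel
  there is a submodule and it acts nilpotently. So all simple modules are isomorphic
  (\<open>simple_modules_iso\<close>), and every projective cover of a simple module is isomorphic to the regular
  module (\<open>projective_cover_regular\<close>). All composition factors being isomorphic, the only
  Cartan number is the length of the regular module (\<open>cartan_matrix_local\<close>).

  It remains to see that each composition series of \<open>A\<close> has four factors. Since \<open>ker \<epsilon>\<close> acts as zero on
  a composition factor, \<open>A\<close> acts there through the scalars. So every step of a series
  raises the dimension over \<open>k\<close> by one, and all series have \<open>dim A\<close> steps
  (\<open>klein_series_length\<close>). An explicit series with four steps (\<open>klein_composition_series\<close>) supplies
  both the existence of a series and the value \<open>dim A = 4\<close>, without recourse to the
  Jordan--Hoelder theorem.\<close>

section \<open>Quotients and composition factors\<close>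

lemma left_module_surj_image:
  assumes M: "left_module R M" and surj: "p ` carrier M = carrier Q"
    and add: "\<And>x y. x \<in> carrier M \<Longrightarrow> y \<in> carrier M \<Longrightarrow> p (x \<oplus>\<^bsub>M\<^esub> y) = p x \<oplus>\<^bsub>Q\<^esub> p y"
    and smult: "\<And>a x. a \<in> carrier R \<Longrightarrow> x \<in> carrier M \<Longrightarrow> p (a \<odot>\<^bsub>M\<^esub> x) = a \<odot>\<^bsub>Q\<^esub> p x"
    and zero: "p \<zero>\<^bsub>M\<^esub> = \<zero>\<^bsub>Q\<^esub>"
  shows "left_module R Q"
proof -
  interpret left_module R M by fact
  note [simp] = add[symmetric] smult[symmetric] zero[symmetric] surj[symmetric]
  show ?thesis
  proof (intro left_module.intro left_module_axioms.intro)
    show "ring R" by (rule R.ring_axioms)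
    show "abelian_group Q"
    proof (rule abelian_groupI)
      fix y assume "y \<in> carrier Q"
      then obtain x where x: "x \<in> carrier M" "y = p x" by auto
      then show "\<exists>z\<in>carrier Q. z \<oplus>\<^bsub>Q\<^esub> y = \<zero>\<^bsub>Q\<^esub>"
        by (intro bexI[of _ "p (\<ominus>\<^bsub>M\<^esub> x)"]) (auto simp: M.l_neg)
    qed (auto simp: M.a_ac)
  qed (auto simp: smult_l_distr smult_r_distr smult_assoc)
qed

lemma left_submodule_module:
  fixes M :: "('a, 'm) module"
  assumes "left_module R M" "left_submodule R M N"
  shows "left_module R (M\<lparr>carrier := N\<rparr>)"
proof -
  interpret left_module R M by fact
  have N: "N \<subseteq> carrier M" "\<zero>\<^bsub>M\<^esub> \<in> N" "\<And>x y. x \<in> N \<Longrightarrow> y \<in> N \<Longrightarrow> x \<oplus>\<^bsub>M\<^esub> y \<in> N"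
    "\<And>a x. a \<in> carrier R \<Longrightarrow> x \<in> N \<Longrightarrow> a \<odot>\<^bsub>M\<^esub> x \<in> N"
    using assms(2) by (auto simp: left_submodule_iff)
  have c: "x \<in> carrier M" if "x \<in> N" for x using that N(1) by auto
  show ?thesis
  proof (intro left_module.intro left_module_axioms.intro)
    show "ring R" by (rule R.ring_axioms)
    show "abelian_group (M\<lparr>carrier := N\<rparr>)"
    proof (rule abelian_groupI)
      fix x assume "x \<in> carrier (M\<lparr>carrier := N\<rparr>)"
      then have x: "x \<in> N" by simp
      then have "\<ominus>\<^bsub>M\<^esub> x \<in> N" using minus_eq_smult[of x] N(4) c by auto
      then show "\<exists>y\<in>carrier (M\<lparr>carrier := N\<rparr>). y \<oplus>\<^bsub>M\<lparr>carrier := N\<rparr>\<^esub> x = \<zero>\<^bsub>M\<lparr>carrier := N\<rparr>\<^esub>"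
        using x c by (intro bexI[of _ "\<ominus>\<^bsub>M\<^esub> x"]) (auto simp: M.l_neg)
    qed (use N c in \<open>auto simp: M.a_ac\<close>)
  qed (use N c in \<open>auto simp: smult_l_distr smult_r_distr smult_assoc\<close>)
qed

lemma quotient_projection:
  fixes M :: "('a, 'm) module"
  assumes M: "left_module R M" and N: "left_submodule R M N"
  defines "p \<equiv> \<lambda>x. N +>\<^bsub>M\<^esub> x"
  shows "left_module R (quotient_module M N)"
    and "p \<in> left_module_hom R M (quotient_module M N)"
    and "p ` carrier M = carrier (quotient_module M N)"
    and "\<And>x. x \<in> carrier M \<Longrightarrow> p x = \<zero>\<^bsub>quotient_module M N\<^esub> \<longleftrightarrow> x \<in> N"
proof -
  interpret left_module R M by fact
  interpret abelian_subgroup N M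
    using N M.abelian_group_axioms by (intro abelian_subgroupI3) (auto simp: left_submodule_def)
  let ?Q = "quotient_module M N"
  have sub: "x \<in> carrier M" if "x \<in> N" for x using a_subset that by auto
  show surj: "p ` carrier M = carrier ?Q"
    by (auto simp: quotient_module_def A_RCOSETS_def' p_def)
  have add: "p (x \<oplus>\<^bsub>M\<^esub> y) = p x \<oplus>\<^bsub>?Q\<^esub> p y" if "x \<in> carrier M" "y \<in> carrier M" for x y
    using that by (simp add: quotient_module_def p_def a_rcos_sum)
  have smult: "p (a \<odot>\<^bsub>M\<^esub> x) = a \<odot>\<^bsub>?Q\<^esub> p x" if a: "a \<in> carrier R" and x: "x \<in> carrier M" for a x
  proof -
    have "N <+>\<^bsub>M\<^esub> (\<lambda>z. a \<odot>\<^bsub>M\<^esub> z) ` (N +>\<^bsub>M\<^esub> x) = N +>\<^bsub>M\<^esub> (a \<odot>\<^bsub>M\<^esub> x)"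
    proof (intro equalityI subsetI)
      fix y assume "y \<in> N <+>\<^bsub>M\<^esub> (\<lambda>z. a \<odot>\<^bsub>M\<^esub> z) ` (N +>\<^bsub>M\<^esub> x)"
      then obtain n n' where n: "n \<in> N" "n' \<in> N" "y = n \<oplus>\<^bsub>M\<^esub> a \<odot>\<^bsub>M\<^esub> (n' \<oplus>\<^bsub>M\<^esub> x)"
        by (auto simp: set_add_def' a_r_coset_def')
      then have "y = (n \<oplus>\<^bsub>M\<^esub> a \<odot>\<^bsub>M\<^esub> n') \<oplus>\<^bsub>M\<^esub> a \<odot>\<^bsub>M\<^esub> x"
        using a x sub by (simp add: smult_r_distr M.a_assoc)
      moreover have "n \<oplus>\<^bsub>M\<^esub> a \<odot>\<^bsub>M\<^esub> n' \<in> N"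
        using N n a by (auto simp: left_submodule_iff)
      ultimately show "y \<in> N +>\<^bsub>M\<^esub> (a \<odot>\<^bsub>M\<^esub> x)" by (auto simp: a_r_coset_def')
    next
      fix y assume "y \<in> N +>\<^bsub>M\<^esub> (a \<odot>\<^bsub>M\<^esub> x)"
      then obtain n where "n \<in> N" "y = n \<oplus>\<^bsub>M\<^esub> a \<odot>\<^bsub>M\<^esub> x" by (auto simp: a_r_coset_def')
      then show "y \<in> N <+>\<^bsub>M\<^esub> (\<lambda>z. a \<odot>\<^bsub>M\<^esub> z) ` (N +>\<^bsub>M\<^esub> x)"
        using a_rcos_self[OF x] by (auto simp: set_add_def')
    qed
    then show ?thesis by (simp add: quotient_module_def p_def)
  qed
  have zero: "p \<zero>\<^bsub>M\<^esub> = \<zero>\<^bsub>?Q\<^esub>"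
    unfolding p_def using a_rcos_const[of "\<zero>\<^bsub>M\<^esub>"] by (simp add: quotient_module_def)
  show "left_module R ?Q" by (rule left_module_surj_image[OF M surj add smult zero])
  show "p \<in> left_module_hom R M ?Q"
    using surj add smult by (auto simp: left_module_hom_def)
  show "p x = \<zero>\<^bsub>?Q\<^esub> \<longleftrightarrow> x \<in> N" if "x \<in> carrier M" for x
    using a_rcos_self[OF that] a_rcos_const[of x] by (auto simp: quotient_module_def p_def)
qed

lemma simple_module_iff_generated:
  assumes "left_module R M"
  shows "simple_module R M \<longleftrightarrow> carrier M \<noteq> {\<zero>\<^bsub>M\<^esub>} \<and>
    (\<forall>x\<in>carrier M. x \<noteq> \<zero>\<^bsub>M\<^esub> \<longrightarrow> carrier M \<subseteq> (\<lambda>a. a \<odot>\<^bsub>M\<^esub> x) ` carrier R)"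
    (is "_ \<longleftrightarrow> ?nz \<and> ?gen")
proof -
  interpret left_module R M by fact
  have ?gen if s: "simple_module R M"
  proof (intro ballI impI)
    fix x assume x: "x \<in> carrier M" "x \<noteq> \<zero>\<^bsub>M\<^esub>"
    have "x \<in> (\<lambda>a. a \<odot>\<^bsub>M\<^esub> x) ` carrier R" using x by (intro image_eqI[of _ _ "\<one>\<^bsub>R\<^esub>"]) auto
    with x s cyclic_submodule[OF x(1)] show "carrier M \<subseteq> (\<lambda>a. a \<odot>\<^bsub>M\<^esub> x) ` carrier R"
      unfolding simple_module_def by blast
  qed
  moreover have "L = {\<zero>\<^bsub>M\<^esub>} \<or> L = carrier M" if ?gen "left_submodule R M L" for L
  proof -
    have L: "L \<subseteq> carrier M" "\<zero>\<^bsub>M\<^esub> \<in> L" "\<And>a x. a \<in> carrier R \<Longrightarrow> x \<in> L \<Longrightarrow> a \<odot>\<^bsub>M\<^esub> x \<in> L"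
      using that(2) by (auto simp: left_submodule_iff)
    show ?thesis
    proof (rule disjCI)
      assume "L \<noteq> carrier M"
      then show "L = {\<zero>\<^bsub>M\<^esub>}" using L that(1) by blast
    qed
  qed
  ultimately show ?thesis using assms unfolding simple_module_def by blast
qed



text \<open>Simplicity of \<open>N' / N\<close> in terms of elements of \<open>M\<close>: each element outside \<open>N\<close> generates \<open>N'\<close>
  modulo \<open>N\<close>. Isomorphisms of \<open>M\<close> visibly preserve this condition, while the cosets that make up
  \<open>series_factor\<close> would have to be transported one by one.\<close>

definition simple_step :: "('a, 'r) ring_scheme \<Rightarrow> ('a, 'm) module \<Rightarrow> 'm set \<Rightarrow> 'm set \<Rightarrow> bool"
  where "simple_step R M N N' \<longleftrightarrow> N \<subset> N' \<and>
    (\<forall>x\<in>N' - N. \<forall>y\<in>N'. \<exists>a\<in>carrier R. \<exists>n\<in>N. y = n \<oplus>\<^bsub>M\<^esub> a \<odot>\<^bsub>M\<^esub> x)"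

lemma series_factor_projection:
  fixes M :: "('a, 'm) module"
  assumes M: "left_module R M" and N: "left_submodule R M (Ns ! i)" "left_submodule R M (Ns ! Suc i)"
    and sub: "Ns ! i \<subseteq> Ns ! Suc i"
  obtains p where "left_module R (series_factor M Ns i)"
    and "p \<in> left_module_hom R (M\<lparr>carrier := Ns ! Suc i\<rparr>) (series_factor M Ns i)"
    and "p ` (Ns ! Suc i) = carrier (series_factor M Ns i)"
    and "\<And>x. x \<in> Ns ! Suc i \<Longrightarrow> p x = \<zero>\<^bsub>series_factor M Ns i\<^esub> \<longleftrightarrow> x \<in> Ns ! i"
proof -
  interpret M: left_module R M by fact
  let ?N = "M\<lparr>carrier := Ns ! Suc i\<rparr>"
  have N': "left_module R ?N" by (rule left_submodule_module[OF M N(2)])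
  interpret N': left_module R ?N by fact
  have "left_submodule R ?N (Ns ! i)"
    using N(1) sub unfolding N'.left_submodule_iff M.left_submodule_iff by simp
  note q = quotient_projection[OF N' this, folded series_factor_def]
  show ?thesis by (rule that[OF q(1,2)]) (use q(3,4) in simp_all)
qed

lemma simple_series_factor_iff:
  fixes M :: "('a, 'm) module"
  assumes M: "left_module R M" and N: "left_submodule R M (Ns ! i)" "left_submodule R M (Ns ! Suc i)"
    and sub: "Ns ! i \<subseteq> Ns ! Suc i"
  shows "simple_module R (series_factor M Ns i) \<longleftrightarrow> simple_step R M (Ns ! i) (Ns ! Suc i)"
proof -
  let ?Q = "series_factor M Ns i" and ?N = "Ns ! i" and ?N' = "Ns ! Suc i"
  interpret M: left_module R M by fact
  obtain p where Q: "left_module R ?Q" and p: "p \<in> left_module_hom R (M\<lparr>carrier := ?N'\<rparr>) ?Q"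
    and surj: "p ` ?N' = carrier ?Q" and ker: "\<And>x. x \<in> ?N' \<Longrightarrow> p x = \<zero>\<^bsub>?Q\<^esub> \<longleftrightarrow> x \<in> ?N"
    using series_factor_projection[OF assms] by blast
  interpret Q: left_module R ?Q by fact
  note h = left_module_homD[OF p, simplified]
  note L = N[unfolded M.left_submodule_iff]
  have eq: "p y = a \<odot>\<^bsub>?Q\<^esub> p x \<longleftrightarrow> (\<exists>n\<in>?N. y = n \<oplus>\<^bsub>M\<^esub> a \<odot>\<^bsub>M\<^esub> x)"
    if x: "x \<in> ?N'" and y: "y \<in> ?N'" and a: "a \<in> carrier R" for x y a
  proof
    assume "\<exists>n\<in>?N. y = n \<oplus>\<^bsub>M\<^esub> a \<odot>\<^bsub>M\<^esub> x"
    then obtain n where n: "n \<in> ?N" "y = n \<oplus>\<^bsub>M\<^esub> a \<odot>\<^bsub>M\<^esub> x" by blast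
    have "n \<in> ?N'" "a \<odot>\<^bsub>M\<^esub> x \<in> ?N'" using n sub x a L by auto
    then show "p y = a \<odot>\<^bsub>?Q\<^esub> p x" using h x a n ker[of n] by simp
  next
    assume e: "p y = a \<odot>\<^bsub>?Q\<^esub> p x"
    define n where "n = y \<oplus>\<^bsub>M\<^esub> (\<ominus>\<^bsub>R\<^esub> a) \<odot>\<^bsub>M\<^esub> x"
    have xy: "x \<in> carrier M" "y \<in> carrier M" using x y L by auto
    have ax: "(\<ominus>\<^bsub>R\<^esub> a) \<odot>\<^bsub>M\<^esub> x \<in> ?N'" using x a L by auto
    have n': "n \<in> ?N'" unfolding n_def using y ax L by auto
    have "p n = a \<odot>\<^bsub>?Q\<^esub> p x \<oplus>\<^bsub>?Q\<^esub> (\<ominus>\<^bsub>R\<^esub> a) \<odot>\<^bsub>?Q\<^esub> p x"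
      unfolding n_def using h(2)[OF y ax] h(3)[of "\<ominus>\<^bsub>R\<^esub> a" x] a x e by simp
    also have "\<dots> = (a \<oplus>\<^bsub>R\<^esub> \<ominus>\<^bsub>R\<^esub> a) \<odot>\<^bsub>?Q\<^esub> p x"
      using a h(1)[OF x] by (intro Q.smult_l_distr[symmetric]) auto
    also have "\<dots> = \<zero>\<^bsub>?Q\<^esub>" using a h(1)[OF x] by (simp add: M.R.r_neg)
    finally have "n \<in> ?N" using ker[OF n'] by simp
    moreover have "n \<oplus>\<^bsub>M\<^esub> a \<odot>\<^bsub>M\<^esub> x = y \<oplus>\<^bsub>M\<^esub> ((\<ominus>\<^bsub>R\<^esub> a) \<odot>\<^bsub>M\<^esub> x \<oplus>\<^bsub>M\<^esub> a \<odot>\<^bsub>M\<^esub> x)"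
      unfolding n_def using a xy by (simp add: M.M.a_assoc)
    moreover have "(\<ominus>\<^bsub>R\<^esub> a) \<odot>\<^bsub>M\<^esub> x \<oplus>\<^bsub>M\<^esub> a \<odot>\<^bsub>M\<^esub> x = (\<ominus>\<^bsub>R\<^esub> a \<oplus>\<^bsub>R\<^esub> a) \<odot>\<^bsub>M\<^esub> x"
      using a xy by (intro M.smult_l_distr[symmetric]) auto
    ultimately show "\<exists>n\<in>?N. y = n \<oplus>\<^bsub>M\<^esub> a \<odot>\<^bsub>M\<^esub> x"
      using a xy by (intro bexI[of _ n]) (simp_all add: M.R.l_neg)
  qed
  have "carrier ?Q = {\<zero>\<^bsub>?Q\<^esub>} \<longleftrightarrow> (\<forall>x\<in>?N'. p x = \<zero>\<^bsub>?Q\<^esub>)"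
    unfolding surj[symmetric] using L by blast
  then have nz: "carrier ?Q \<noteq> {\<zero>\<^bsub>?Q\<^esub>} \<longleftrightarrow> ?N \<noteq> ?N'" using ker sub by auto
  have "(\<forall>x\<in>carrier ?Q. x \<noteq> \<zero>\<^bsub>?Q\<^esub> \<longrightarrow> carrier ?Q \<subseteq> (\<lambda>a. a \<odot>\<^bsub>?Q\<^esub> x) ` carrier R) \<longleftrightarrow>
    (\<forall>x\<in>?N' - ?N. \<forall>y\<in>?N'. \<exists>a\<in>carrier R. p y = a \<odot>\<^bsub>?Q\<^esub> p x)"
    unfolding surj[symmetric] using ker by (simp add: image_subset_iff image_iff) blast
  also have "\<dots> \<longleftrightarrow> (\<forall>x\<in>?N' - ?N. \<forall>y\<in>?N'. \<exists>a\<in>carrier R. \<exists>n\<in>?N. y = n \<oplus>\<^bsub>M\<^esub> a \<odot>\<^bsub>M\<^esub> x)"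
    using eq by auto
  finally show ?thesis
    using nz sub unfolding simple_module_iff_generated[OF Q] simple_step_def by blast
qed

lemma composition_series_iff:
  fixes M :: "('a, 'm) module"
  assumes M: "left_module R M"
  shows "composition_series R M Ns \<longleftrightarrow>
    Ns \<noteq> [] \<and> hd Ns = {\<zero>\<^bsub>M\<^esub>} \<and> last Ns = carrier M \<and> (\<forall>N\<in>set Ns. left_submodule R M N) \<and>
    (\<forall>i. Suc i < length Ns \<longrightarrow> simple_step R M (Ns ! i) (Ns ! Suc i))"
proof -
  have "Ns ! i \<subseteq> Ns ! Suc i \<and> simple_module R (series_factor M Ns i) \<longleftrightarrow>
      simple_step R M (Ns ! i) (Ns ! Suc i)"
    if "\<forall>N\<in>set Ns. left_submodule R M N" "Suc i < length Ns" for i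
    using that simple_series_factor_iff[OF M, of Ns i]
    by (auto simp: simple_step_def)
  then show ?thesis unfolding composition_series_def by blast
qed

lemma composition_series_image:
  fixes M :: "('a, 'm) module" and N :: "('a, 'n) module"
  assumes M: "left_module R M" and N: "left_module R N"
    and f: "f \<in> left_module_hom R M N" and bij: "bij_betw f (carrier M) (carrier N)"
    and cs: "composition_series R M Ns"
  shows "composition_series R N (map (image f) Ns)"
proof -
  interpret M: left_module R M by fact
  note h = left_module_homD[OF f]
  have inj: "inj_on f (carrier M)" using bij by (simp add: bij_betw_def)
  have cs': "Ns \<noteq> []" "hd Ns = {\<zero>\<^bsub>M\<^esub>}" "last Ns = carrier M"
    "\<And>K. K \<in> set Ns \<Longrightarrow> left_submodule R M K"
    "\<And>i. Suc i < length Ns \<Longrightarrow> simple_step R M (Ns ! i) (Ns ! Suc i)"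
    using cs by (auto simp: composition_series_iff[OF M])
  have step: "simple_step R N (f ` (Ns ! i)) (f ` (Ns ! Suc i))" if i: "Suc i < length Ns" for i
  proof -
    let ?K = "Ns ! i" and ?K' = "Ns ! Suc i"
    have s: "?K \<subset> ?K'"
      "\<And>x y. x \<in> ?K' \<Longrightarrow> x \<notin> ?K \<Longrightarrow> y \<in> ?K' \<Longrightarrow> \<exists>a\<in>carrier R. \<exists>n\<in>?K. y = n \<oplus>\<^bsub>M\<^esub> a \<odot>\<^bsub>M\<^esub> x"
      using cs'(5)[OF i] by (auto simp: simple_step_def)
    have K': "?K' \<subseteq> carrier M"
      using cs'(4)[of ?K'] i by (simp add: M.left_submodule_iff)
    have "f ` ?K \<subset> f ` ?K'" using image_strict_mono[OF inj_on_subset[OF inj K'] s(1)] .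
    moreover have "\<exists>a\<in>carrier R. \<exists>n\<in>f ` ?K. f y = n \<oplus>\<^bsub>N\<^esub> a \<odot>\<^bsub>N\<^esub> f x"
      if xy: "x \<in> ?K'" "f x \<notin> f ` ?K" "y \<in> ?K'" for x y
    proof -
      obtain a n where an: "a \<in> carrier R" "n \<in> ?K" "y = n \<oplus>\<^bsub>M\<^esub> a \<odot>\<^bsub>M\<^esub> x"
        using s(2)[of x y] xy by blast
      have "n \<in> carrier M" "x \<in> carrier M" using an xy s(1) K' by auto
      then have "f y = f n \<oplus>\<^bsub>N\<^esub> a \<odot>\<^bsub>N\<^esub> f x" using an h by simp
      then show ?thesis using an by blast
    qed
    ultimately show ?thesis unfolding simple_step_def by blast
  qed
  have "last (map (image f) Ns) = carrier N"
    using cs'(1,3) bij by (simp add: last_map bij_betw_def)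
  moreover have "hd (map (image f) Ns) = {\<zero>\<^bsub>N\<^esub>}"
    using cs'(1,2) left_module_hom_zero[OF M N f] by (simp add: hd_map)
  ultimately show ?thesis
    unfolding composition_series_iff[OF N]
    using cs'(1,4) step left_submodule_image[OF M N f] by auto
qed

section \<open>Commutative local rings with nil maximal ideal\<close>

locale local_nil_ring = cring +
  assumes one_not_zero: "\<one> \<noteq> \<zero>"
    and unit_or_nilpotent: "a \<in> carrier R \<Longrightarrow> a \<in> Units R \<or> (\<exists>n::nat. a [^] n = \<zero>)"
begin

text \<open>By commutativity the kernel of \<open>a\<close> on \<open>S\<close> is a submodule. If it were zero, no power of \<open>a\<close>
  could act as zero.\<close>

lemma nonunit_annihilates_simple:
  fixes S :: "('a, 's) module"
  assumes S: "simple_module R S" and a: "a \<in> carrier R" "a \<notin> Units R" and x: "x \<in> carrier S"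
  shows "a \<odot>\<^bsub>S\<^esub> x = \<zero>\<^bsub>S\<^esub>"
proof (rule ccontr)
  assume nz: "a \<odot>\<^bsub>S\<^esub> x \<noteq> \<zero>\<^bsub>S\<^esub>"
  have S': "left_module R S" using S by (simp add: simple_module_def)
  interpret S: left_module R S by fact
  let ?K = "{y \<in> carrier S. a \<odot>\<^bsub>S\<^esub> y = \<zero>\<^bsub>S\<^esub>}"
  have "left_submodule R S ?K"
    unfolding S.left_submodule_iff
  proof (intro conjI ballI)
    fix b y assume bk: "b \<in> carrier R" "y \<in> ?K"
    have "a \<odot>\<^bsub>S\<^esub> (b \<odot>\<^bsub>S\<^esub> y) = (a \<otimes> b) \<odot>\<^bsub>S\<^esub> y"
      using bk a(1) by (simp add: S.smult_assoc)
    also have "\<dots> = b \<odot>\<^bsub>S\<^esub> (a \<odot>\<^bsub>S\<^esub> y)"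
      using bk a(1) by (simp add: m_comm[of a b] S.smult_assoc)
    finally show "b \<odot>\<^bsub>S\<^esub> y \<in> ?K" using bk a(1) by simp
  qed (use a(1) in \<open>auto simp: S.smult_r_distr\<close>)
  then have K: "?K = {\<zero>\<^bsub>S\<^esub>}" using S x nz unfolding simple_module_def by blast
  have "a [^] n \<odot>\<^bsub>S\<^esub> x \<noteq> \<zero>\<^bsub>S\<^esub>" for n :: nat
  proof (induction n)
    case 0
    then show ?case using nz x a(1) by auto
  next
    case (Suc n)
    have "a [^] Suc n \<odot>\<^bsub>S\<^esub> x = a \<odot>\<^bsub>S\<^esub> (a [^] n \<odot>\<^bsub>S\<^esub> x)"
      using a(1) x by (simp add: S.smult_assoc[symmetric] m_comm)
    moreover have "a [^] n \<odot>\<^bsub>S\<^esub> x \<notin> ?K" using K Suc by blast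
    ultimately show ?case using a(1) x by simp
  qed
  then show False using unit_or_nilpotent[OF a(1)] a(2) x by (metis S.smult_l_null)
qed

lemma smult_unit_eq_zero:
  assumes "left_module R M" "u \<in> Units R" "x \<in> carrier M" "u \<odot>\<^bsub>M\<^esub> x = \<zero>\<^bsub>M\<^esub>"
  shows "x = \<zero>\<^bsub>M\<^esub>"
proof -
  interpret left_module R M by fact
  have "x = (inv u \<otimes> u) \<odot>\<^bsub>M\<^esub> x" using assms by (simp add: Units_l_inv)
  also have "\<dots> = inv u \<odot>\<^bsub>M\<^esub> (u \<odot>\<^bsub>M\<^esub> x)" using assms by (intro smult_assoc) auto
  also have "\<dots> = \<zero>\<^bsub>M\<^esub>" using assms by simp
  finally show ?thesis .
qed

lemma simple_smult_eq_zero_iff: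
  fixes S :: "('a, 's) module"
  assumes S: "simple_module R S" and x: "x \<in> carrier S" "x \<noteq> \<zero>\<^bsub>S\<^esub>" and a: "a \<in> carrier R"
  shows "a \<odot>\<^bsub>S\<^esub> x = \<zero>\<^bsub>S\<^esub> \<longleftrightarrow> a \<notin> Units R"
  using nonunit_annihilates_simple[OF S a _ x(1)] smult_unit_eq_zero[of S a x] S x
  by (auto simp: simple_module_def)

lemma simple_smult_eq_iff:
  fixes S :: "('a, 's) module"
  assumes S: "simple_module R S" and x: "x \<in> carrier S" "x \<noteq> \<zero>\<^bsub>S\<^esub>"
    and ab: "a \<in> carrier R" "b \<in> carrier R"
  shows "a \<odot>\<^bsub>S\<^esub> x = b \<odot>\<^bsub>S\<^esub> x \<longleftrightarrow> a \<ominus> b \<notin> Units R"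
proof -
  interpret S: left_module R S using S by (simp add: simple_module_def)
  have "a = (a \<ominus> b) \<oplus> b" using ab by (simp add: minus_eq a_assoc l_neg)
  then have "a \<odot>\<^bsub>S\<^esub> x = (a \<ominus> b) \<odot>\<^bsub>S\<^esub> x \<oplus>\<^bsub>S\<^esub> b \<odot>\<^bsub>S\<^esub> x"
    using S.smult_l_distr[of "a \<ominus> b" b x] ab x by simp
  then have "a \<odot>\<^bsub>S\<^esub> x = b \<odot>\<^bsub>S\<^esub> x \<longleftrightarrow> (a \<ominus> b) \<odot>\<^bsub>S\<^esub> x = \<zero>\<^bsub>S\<^esub>"
    using ab x by simp
  then show ?thesis using simple_smult_eq_zero_iff[OF S x] ab by simp
qed

text \<open>The annihilator of a nonzero element is the set of non-units in both modules, so \<open>a x \<mapsto> a t\<close> is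
  well defined and injective.\<close>

lemma simple_modules_iso:
  fixes S :: "('a, 's) module" and T :: "('a, 't) module"
  assumes S: "simple_module R S" and T: "simple_module R T"
  shows "left_module_iso R S T"
proof -
  have S': "left_module R S" and T': "left_module R T"
    using S T by (simp_all add: simple_module_def)
  interpret S: left_module R S by fact
  interpret T: left_module R T by fact
  obtain x where x: "x \<in> carrier S" "x \<noteq> \<zero>\<^bsub>S\<^esub>" using S by (auto simp: simple_module_def)
  obtain t where t: "t \<in> carrier T" "t \<noteq> \<zero>\<^bsub>T\<^esub>" using T by (auto simp: simple_module_def)
  have gen: "carrier S = (\<lambda>a. a \<odot>\<^bsub>S\<^esub> x) ` carrier R" "carrier T = (\<lambda>a. a \<odot>\<^bsub>T\<^esub> t) ` carrier R"
    using S T x t by (auto simp: simple_module_iff_generated[OF S'] simple_module_iff_generated[OF T'])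
  define c where "c = inv_into (carrier R) (\<lambda>a. a \<odot>\<^bsub>S\<^esub> x)"
  have c: "c y \<in> carrier R" "c y \<odot>\<^bsub>S\<^esub> x = y" if "y \<in> carrier S" for y
    using that gen(1) inv_into_into[of y "\<lambda>a. a \<odot>\<^bsub>S\<^esub> x" "carrier R"]
      f_inv_into_f[of y "\<lambda>a. a \<odot>\<^bsub>S\<^esub> x" "carrier R"] by (simp_all add: c_def)
  define f where "f y = c y \<odot>\<^bsub>T\<^esub> t" for y
  have f: "f (a \<odot>\<^bsub>S\<^esub> x) = a \<odot>\<^bsub>T\<^esub> t" if a: "a \<in> carrier R" for a
    using simple_smult_eq_iff[OF S x _ a, of "c (a \<odot>\<^bsub>S\<^esub> x)"] simple_smult_eq_iff[OF T t _ a, of "c (a \<odot>\<^bsub>S\<^esub> x)"]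
      c[of "a \<odot>\<^bsub>S\<^esub> x"] a x by (simp add: f_def)
  have "f \<in> left_module_hom R S T"
    unfolding left_module_hom_def
  proof (intro CollectI conjI ballI)
    show "f \<in> carrier S \<rightarrow> carrier T" using c t by (auto simp: f_def)
    show "f (y \<oplus>\<^bsub>S\<^esub> z) = f y \<oplus>\<^bsub>T\<^esub> f z" if yz: "y \<in> carrier S" "z \<in> carrier S" for y z
    proof -
      obtain a b where ab: "a \<in> carrier R" "b \<in> carrier R" "y = a \<odot>\<^bsub>S\<^esub> x" "z = b \<odot>\<^bsub>S\<^esub> x"
        using yz unfolding gen(1) by blast
      then have "y \<oplus>\<^bsub>S\<^esub> z = (a \<oplus> b) \<odot>\<^bsub>S\<^esub> x" using x by (simp add: S.smult_l_distr)
      then show ?thesis using ab t by (simp add: f T.smult_l_distr)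
    qed
    show "f (b \<odot>\<^bsub>S\<^esub> y) = b \<odot>\<^bsub>T\<^esub> f y" if b: "b \<in> carrier R" and y: "y \<in> carrier S" for b y
    proof -
      obtain a where a: "a \<in> carrier R" "y = a \<odot>\<^bsub>S\<^esub> x"
        using y unfolding gen(1) by blast
      then have "b \<odot>\<^bsub>S\<^esub> y = (b \<otimes> a) \<odot>\<^bsub>S\<^esub> x" using b x by (simp add: S.smult_assoc)
      then show ?thesis using a b t by (simp add: f T.smult_assoc)
    qed
  qed
  moreover have "bij_betw f (carrier S) (carrier T)"
    unfolding bij_betw_def
  proof
    show "f ` carrier S = carrier T" unfolding gen using f by (force simp: image_image)
    show "inj_on f (carrier S)"
      unfolding gen(1) using simple_smult_eq_iff[OF S x] simple_smult_eq_iff[OF T t] by (auto intro!: inj_onI simp: f)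
  qed
  ultimately show ?thesis unfolding left_module_iso_def by blast
qed

text \<open>The action on the composition factor read off in \<open>M\<close>: multiplication by a non-unit moves one step
  down the series.\<close>

lemma nonunit_composition_series:
  fixes M :: "('a, 'm) module"
  assumes M: "left_module R M" and cs: "composition_series R M Ns" and i: "Suc i < length Ns"
    and a: "a \<in> carrier R" "a \<notin> Units R" and x: "x \<in> Ns ! Suc i"
  shows "a \<odot>\<^bsub>M\<^esub> x \<in> Ns ! i"
proof -
  interpret M: left_module R M by fact
  have sub: "left_submodule R M (Ns ! i)" "left_submodule R M (Ns ! Suc i)" "Ns ! i \<subseteq> Ns ! Suc i"
    and simple: "simple_module R (series_factor M Ns i)"
    using cs i by (auto simp: composition_series_def)
  obtain p where p: "p \<in> left_module_hom R (M\<lparr>carrier := Ns ! Suc i\<rparr>) (series_factor M Ns i)"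
    "\<And>x. x \<in> Ns ! Suc i \<Longrightarrow> p x = \<zero>\<^bsub>series_factor M Ns i\<^esub> \<longleftrightarrow> x \<in> Ns ! i"
    using series_factor_projection[OF M sub] by metis
  note h = left_module_homD[OF p(1), simplified]
  have "p (a \<odot>\<^bsub>M\<^esub> x) = \<zero>\<^bsub>series_factor M Ns i\<^esub>"
    using nonunit_annihilates_simple[OF simple a h(1)[OF x]] h(3)[OF a(1) x] by simp
  moreover have "a \<odot>\<^bsub>M\<^esub> x \<in> Ns ! Suc i" using sub(2) a x by (simp add: M.left_submodule_iff)
  ultimately show ?thesis using p(2) by simp
qed

end

section \<open>The regular module as projective cover\<close>

definition regular_module :: "('a, 'r) ring_scheme \<Rightarrow> ('a, 'a) module"
  where "regular_module R = \<lparr>carrier = carrier R, monoid.mult = undefined, monoid.one = undefined,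
    ring.zero = \<zero>\<^bsub>R\<^esub>, ring.add = ring.add R, module.smult = monoid.mult R\<rparr>"

lemma regular_module_simps [simp]:
  "carrier (regular_module R) = carrier R"
  "\<zero>\<^bsub>regular_module R\<^esub> = \<zero>\<^bsub>R\<^esub>"
  "x \<oplus>\<^bsub>regular_module R\<^esub> y = x \<oplus>\<^bsub>R\<^esub> y"
  "x \<odot>\<^bsub>regular_module R\<^esub> y = x \<otimes>\<^bsub>R\<^esub> y"
  by (simp_all add: regular_module_def)

context ring
begin

lemma regular_left_module: "left_module R (regular_module R)"
proof (intro left_module.intro left_module_axioms.intro)
  show "ring R" by (rule ring_axioms)
  show "abelian_group (regular_module R)"
    by (rule abelian_groupI) (auto simp: a_ac intro: bexI[of _ "\<ominus> x" for x] l_neg)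
qed (auto simp: l_distr r_distr m_assoc)

lemma regular_module_hom:
  assumes "left_module R M" "x \<in> carrier M"
  shows "(\<lambda>a. a \<odot>\<^bsub>M\<^esub> x) \<in> left_module_hom R (regular_module R) M"
proof -
  interpret left_module R M by fact
  show ?thesis using assms(2) by (auto simp: left_module_hom_def smult_l_distr smult_assoc)
qed

lemma regular_module_projective: "projective_module R (regular_module R)"
  unfolding projective_module_def
proof (intro conjI allI ballI impI)
  fix M :: "('a, 'a \<Rightarrow> 'a) module" and N :: "('a, 'a) module" and g f
  assume g: "g \<in> left_module_hom R M N" and f: "f \<in> left_module_hom R (regular_module R) N"
    and *: "left_module R M \<and> left_module R N \<and> g ` carrier M = carrier N"
  note f' = left_module_homD[OF f, simplified]
  obtain m where m: "m \<in> carrier M" "g m = f \<one>"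
    using * f'(1)[OF one_closed] by (metis imageE)
  have "g (a \<odot>\<^bsub>M\<^esub> m) = f a" if "a \<in> carrier R" for a
    using left_module_homD(3)[OF g that m(1)] f'(3)[OF that one_closed] m that by simp
  then show "\<exists>h\<in>left_module_hom R (regular_module R) M. \<forall>x\<in>carrier (regular_module R). g (h x) = f x"
    using regular_module_hom[of M m] m(1) * by (intro bexI[of _ "\<lambda>a. a \<odot>\<^bsub>M\<^esub> m"]) auto
qed (rule regular_left_module)

end

context local_nil_ring
begin

text \<open>The cover is essential because a submodule that still reaches \<open>t\<close> contains some \<open>u\<close> with \<open>u t = t\<close>,
  which is a unit.\<close>

lemma regular_projective_cover:
  fixes T :: "('a, 't) module"
  assumes T: "simple_module R T" and t: "t \<in> carrier T" "t \<noteq> \<zero>\<^bsub>T\<^esub>"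
  shows "projective_cover R T (regular_module R) (\<lambda>a. a \<odot>\<^bsub>T\<^esub> t)"
proof -
  have T': "left_module R T" using T by (simp add: simple_module_def)
  interpret T: left_module R T by fact
  interpret reg: left_module R "regular_module R" by (rule regular_left_module)
  have "L = carrier R"
    if L: "left_submodule R (regular_module R) L" and surj: "(\<lambda>a. a \<odot>\<^bsub>T\<^esub> t) ` L = carrier T" for L
  proof -
    have L': "L \<subseteq> carrier R" "\<And>a x. a \<in> carrier R \<Longrightarrow> x \<in> L \<Longrightarrow> a \<otimes> x \<in> L"
      using L by (auto simp: reg.left_submodule_iff)
    obtain u where u: "u \<in> L" "u \<odot>\<^bsub>T\<^esub> t = t" using surj t(1) by (metis imageE)
    then have "u \<in> Units R" using simple_smult_eq_zero_iff[OF T t, of u] t(2) L'(1) by auto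
    then have "a \<in> L" if "a \<in> carrier R" for a
      using that L'(2)[of "a \<otimes> inv u" u] u(1) \<open>u \<in> Units R\<close> by (simp add: m_assoc Units_l_inv Units_closed)
    then show ?thesis using L'(1) by auto
  qed
  moreover have "(\<lambda>a. a \<odot>\<^bsub>T\<^esub> t) ` carrier R = carrier T"
    using T t by (auto simp: simple_module_iff_generated[OF T'])
  ultimately show ?thesis
    using regular_module_projective regular_module_hom[OF T' t(1)]
    by (auto simp: projective_cover_def essential_epi_def)
qed

text \<open>As the cover is essential, \<open>P = R x\<close> for any \<open>x\<close> with nonzero image in \<open>T\<close>. Projectivity splits
  the surjection \<open>a \<mapsto> a x\<close> from \<open>R\<close>; the splitting sends \<open>x\<close> to an element \<open>e\<close> with \<open>e x = x\<close>. No power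
  of \<open>e\<close> is zero, so \<open>e\<close> is a unit, and \<open>a e\<close> depends only on \<open>a x\<close>. Hence \<open>a \<mapsto> a x\<close> is injective.\<close>

lemma projective_cover_regular:
  fixes P :: "('a, 'p) module" and T :: "('a, 't) module"
  assumes T: "simple_module R T" and P: "projective_cover R T P f"
  shows "\<exists>g\<in>left_module_hom R (regular_module R) P. bij_betw g (carrier R) (carrier P)"
proof -
  have T': "left_module R T" using T by (simp add: simple_module_def)
  have pP: "projective_module R P" and f: "f \<in> left_module_hom R P T" "f ` carrier P = carrier T"
    and ess: "\<And>L. left_submodule R P L \<Longrightarrow> f ` L = carrier T \<Longrightarrow> L = carrier P"
    using P by (auto simp: projective_cover_def essential_epi_def)
  have P': "left_module R P" using pP by (simp add: projective_module_def)
  interpret T: left_module R T by fact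
  interpret P: left_module R P by fact
  obtain t where t: "t \<in> carrier T" "t \<noteq> \<zero>\<^bsub>T\<^esub>" using T by (auto simp: simple_module_def)
  then obtain x where x: "x \<in> carrier P" "f x = t" using f(2) by (metis imageE)
  have x0: "x \<noteq> \<zero>\<^bsub>P\<^esub>" using left_module_hom_zero[OF P' T' f(1)] x t by auto
  let ?g = "\<lambda>a. a \<odot>\<^bsub>P\<^esub> x"
  have g: "?g \<in> left_module_hom R (regular_module R) P" by (rule regular_module_hom[OF P' x(1)])
  have "f ` ?g ` carrier R = (\<lambda>a. a \<odot>\<^bsub>T\<^esub> t) ` carrier R"
    using left_module_homD(3)[OF f(1) _ x(1)] x(2) by (auto simp: image_image)
  also have "\<dots> = carrier T" using T t by (auto simp: simple_module_iff_generated[OF T'])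
  finally have surj: "?g ` carrier R = carrier P" by (rule ess[OF P.cyclic_submodule[OF x(1)]])
  have "(\<lambda>y. y) \<in> left_module_hom R P P" by (auto simp: left_module_hom_def)
  then have "\<exists>h\<in>left_module_hom R P (regular_module R). \<forall>y\<in>carrier P. h y \<odot>\<^bsub>P\<^esub> x = y"
    using surj by (intro projective_module_lift[OF pP regular_left_module P' g]) auto
  then obtain h where h: "h \<in> left_module_hom R P (regular_module R)"
    and gh: "\<And>y. y \<in> carrier P \<Longrightarrow> h y \<odot>\<^bsub>P\<^esub> x = y" by blast
  note hD = left_module_homD[OF h, simplified]
  have e: "h x \<in> carrier R" by (rule hD(1)[OF x(1)])
  have "h x [^] n \<odot>\<^bsub>P\<^esub> x = x" for n :: nat
  proof (induction n)
    case (Suc n)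
    then show ?case using e x(1) gh[OF x(1)] P.smult_assoc[of "h x [^] n" "h x" x] by simp
  qed (use x in auto)
  then have "h x [^] n \<noteq> \<zero>" for n :: nat using x0 x(1) by (metis P.smult_l_null)
  then have u: "h x \<in> Units R" using unit_or_nilpotent[OF e] by auto
  have "inj_on ?g (carrier R)"
  proof (rule inj_onI)
    fix a b assume ab: "a \<in> carrier R" "b \<in> carrier R" "a \<odot>\<^bsub>P\<^esub> x = b \<odot>\<^bsub>P\<^esub> x"
    then have "a \<otimes> h x = b \<otimes> h x" using hD(3)[OF _ x(1)] by metis
    then show "a = b" using u e ab by (simp add: m_comm[of _ "h x"])
  qed
  then show ?thesis using g surj by (auto simp: bij_betw_def)
qed

text \<open>The common length of the composition series of the regular module is a hypothesis, in place of the
  Jordan--Hoelder theorem: it makes the definite descriptions in \<open>composition_multiplicity\<close> and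
  \<open>cartan_matrix\<close> denote. The isomorphism from the regular module to a projective cover carries
  series in both directions.\<close>

theorem cartan_matrix_local:
  assumes Ns: "composition_series R (regular_module R) Ns"
    and len: "\<And>Ms. composition_series R (regular_module R) Ms \<Longrightarrow> length Ms = Suc n"
  shows "simple_module_types R = {Collect (simple_module R)}"
    and "cartan_matrix R (Collect (simple_module R)) (Collect (simple_module R)) = n"
proof -
  let ?S = "Collect (simple_module R) :: ('a, 'a) module set"
  note reg = regular_left_module
  have "n > 0"
  proof (rule ccontr)
    assume "\<not> n > 0"
    then obtain N where "Ns = [N]" using len[OF Ns] by (auto simp: length_Suc_conv)
    then have "carrier R = {\<zero>}" using Ns by (simp add: composition_series_def) metis
    then show False using one_not_zero one_closed by auto
  qed
  \<comment> \<open>The first composition factor serves as a simple module; its copy has elements of the ring as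
    carrier.\<close>
  then have "simple_module R (series_factor (regular_module R) Ns 0)"
    using Ns len[OF Ns] by (simp add: composition_series_def)
  then obtain T0 :: "('a, 'a) module" where T0: "simple_module R T0"
    using simple_module_copy by blast
  have "simple_module_types R = {?S | S :: ('a, 'a) module. simple_module R S}"
    unfolding simple_module_types_def using simple_modules_iso by blast
  then show "simple_module_types R = {?S}" using T0 by auto
  have mult: "composition_multiplicity R P S = n"
    if S: "simple_module R S" and T: "simple_module R T" and P: "projective_cover R T P f"
    for S T P :: "('a, 'a) module" and f
  proof -
    have P': "left_module R P" using P by (simp add: projective_cover_def projective_module_def)
    obtain g where g: "g \<in> left_module_hom R (regular_module R) P"
      "bij_betw g (carrier (regular_module R)) (carrier P)"
      using projective_cover_regular[OF T P] by auto
    let ?h = "inv_into (carrier (regular_module R)) g"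
    have h: "?h \<in> left_module_hom R P (regular_module R)"
      "bij_betw ?h (carrier P) (carrier (regular_module R))"
      using left_module_hom_inv[OF reg g] bij_betw_inv_into[OF g(2)] by auto
    have count: "card {i. Suc i < length Ms \<and> left_module_iso R S (series_factor P Ms i)} = n"
      if Ms: "composition_series R P Ms" for Ms
    proof -
      have "length Ms = Suc n"
        using len[OF composition_series_image[OF P' reg h Ms]] by simp
      then have "{i. Suc i < length Ms \<and> left_module_iso R S (series_factor P Ms i)} = {..<n}"
        using Ms by (auto simp: composition_series_def intro: simple_modules_iso[OF S])
      then show ?thesis by simp
    qed
    show ?thesis
      unfolding composition_multiplicity_def
      using count composition_series_image[OF reg P' g Ns] by (intro the_equality) auto
  qed
  interpret T0: left_module R T0 using T0 by (simp add: simple_module_def)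
  obtain t where "t \<in> carrier T0" "t \<noteq> \<zero>\<^bsub>T0\<^esub>"
    using T0 T0.zero_closed by (auto simp: simple_module_def)
  from regular_projective_cover[OF T0 this] have cover:
    "projective_cover R T0 (regular_module R) (\<lambda>a. a \<odot>\<^bsub>T0\<^esub> t)" .
  have "(\<exists>S\<in>?S. \<exists>T\<in>?S. \<exists>(P :: ('a, 'a) module) f. projective_cover R T P f \<and>
      m = composition_multiplicity R P S) \<longleftrightarrow> m = n" for m
    using mult T0 cover by (metis mem_Collect_eq)
  then show "cartan_matrix R ?S ?S = n" unfolding cartan_matrix_def by simp
qed

end

section \<open>The group algebra of the Klein four-group in characteristic two\<close>

abbreviation klein_algebra :: "('k::field, int \<times> int \<Rightarrow> 'k) module"
  where "klein_algebra \<equiv> group_algebra klein_four_group"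

text \<open>The coefficients stand in the order of the group elements \<open>1\<close>, \<open>h\<close>, \<open>g\<close>, \<open>g h\<close>, where
  \<open>g = (1, 0)\<close> and \<open>h = (0, 1)\<close>. In particular \<open>klein_elt c 0 0 0\<close> is the scalar \<open>c\<close>.\<close>

definition klein_elt :: "'k \<Rightarrow> 'k \<Rightarrow> 'k \<Rightarrow> 'k \<Rightarrow> int \<times> int \<Rightarrow> 'k::zero"
  where "klein_elt a b c d = (\<lambda>x. if x = (0, 0) then a else if x = (0, 1) then b
    else if x = (1, 0) then c else if x = (1, 1) then d else 0)"

lemma klein_elt_simps [simp]:
  "klein_elt a b c d (0, 0) = a" "klein_elt a b c d (0, 1) = b"
  "klein_elt a b c d (1, 0) = c" "klein_elt a b c d (1, 1) = d"
  by (simp_all add: klein_elt_def)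

lemma klein_elt_zero [simp]: "klein_elt 0 0 0 0 = (\<lambda>x. 0)"
  by (auto simp: klein_elt_def)

definition augmentation :: "(int \<times> int \<Rightarrow> 'k) \<Rightarrow> 'k::field"
  where "augmentation f = f (0, 0) + f (0, 1) + f (1, 0) + f (1, 1)"

lemma carrier_klein_four_group: "carrier klein_four_group = {(0, 0), (0, 1), (1, 0), (1, 1)}"
proof -
  have "{0..<2::int} = {0, 1}" by auto
  then show ?thesis by (auto simp: carrier_integer_mod_group)
qed

lemma group_klein_four_group: "group klein_four_group"
  by (intro DirProd_group group_integer_mod_group)

lemma klein_carrier:
  "f \<in> carrier klein_algebra \<longleftrightarrow>
    (\<forall>x. x \<notin> {(0, 0), (0, 1), (1, 0), (1, 1)} \<longrightarrow> f x = 0)"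
proof -
  have "f \<in> carrier klein_algebra \<longleftrightarrow> {x. f x \<noteq> 0} \<subseteq> carrier klein_four_group"
    using finite_subset[of "{x. f x \<noteq> 0}" "carrier klein_four_group"]
    unfolding group_algebra_def carrier_klein_four_group by auto
  then show ?thesis unfolding carrier_klein_four_group by blast
qed

lemma klein_elt_carrier [simp, intro]: "klein_elt a b c d \<in> carrier klein_algebra"
  by (simp add: klein_carrier klein_elt_def)

lemma klein_ext:
  assumes "f \<in> carrier klein_algebra" "g \<in> carrier klein_algebra"
    and "f (0, 0) = g (0, 0)" "f (0, 1) = g (0, 1)" "f (1, 0) = g (1, 0)" "f (1, 1) = g (1, 1)"
  shows "f = g"
proof
  fix x
  show "f x = g x"
  proof (cases "x \<in> {(0, 0), (0, 1), (1, 0), (1, 1)}")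
    case False
    then have "f x = 0" "g x = 0" using assms(1,2) unfolding klein_carrier by blast+
    then show ?thesis by simp
  qed (use assms in auto)
qed

lemma klein_add [simp]: "(f \<oplus>\<^bsub>klein_algebra\<^esub> g) = (\<lambda>x. f x + g x)"
  and klein_zero [simp]: "\<zero>\<^bsub>klein_algebra\<^esub> = (\<lambda>x. 0)"
  and klein_one: "\<one>\<^bsub>klein_algebra\<^esub> = klein_elt 1 0 0 0"
  by (auto simp: group_algebra_def klein_elt_def)

lemma klein_mult:
  assumes f: "f \<in> carrier klein_algebra"
  shows "f \<otimes>\<^bsub>klein_algebra\<^esub> g = klein_elt
    (f (0, 0) * g (0, 0) + f (0, 1) * g (0, 1) + f (1, 0) * g (1, 0) + f (1, 1) * g (1, 1))
    (f (0, 0) * g (0, 1) + f (0, 1) * g (0, 0) + f (1, 0) * g (1, 1) + f (1, 1) * g (1, 0))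
    (f (0, 0) * g (1, 0) + f (0, 1) * g (1, 1) + f (1, 0) * g (0, 0) + f (1, 1) * g (0, 1))
    (f (0, 0) * g (1, 1) + f (0, 1) * g (1, 0) + f (1, 0) * g (0, 1) + f (1, 1) * g (0, 0))"
    (is "_ = ?rhs")
proof
  fix x
  let ?G = "klein_four_group"
  have conv: "(f \<otimes>\<^bsub>klein_algebra\<^esub> g) x = (if x \<in> carrier ?G
      then \<Sum>y\<in>carrier ?G. f y * g (inv\<^bsub>?G\<^esub> y \<otimes>\<^bsub>?G\<^esub> x) else 0)"
  proof -
    have "(\<Sum>y | f y \<noteq> 0. f y * g (inv\<^bsub>?G\<^esub> y \<otimes>\<^bsub>?G\<^esub> x)) =
      (\<Sum>y\<in>carrier ?G. f y * g (inv\<^bsub>?G\<^esub> y \<otimes>\<^bsub>?G\<^esub> x))"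
    proof (rule sum.mono_neutral_left)
      show "finite (carrier ?G)" unfolding carrier_klein_four_group by simp
    qed (use f in \<open>auto simp: group_algebra_def\<close>)
    then show ?thesis by (simp add: group_algebra_def)
  qed
  have inv: "inv\<^bsub>?G\<^esub> y = y" if "y \<in> carrier ?G" for y
    by (rule group.inv_equality[OF group_klein_four_group])
      (use that in \<open>auto simp: carrier_klein_four_group carrier_integer_mod_group\<close>)
  have sum: "(\<Sum>y\<in>carrier ?G. f y * g (inv\<^bsub>?G\<^esub> y \<otimes>\<^bsub>?G\<^esub> x)) =
      f (0, 0) * g ((0, 0) \<otimes>\<^bsub>?G\<^esub> x) + f (0, 1) * g ((0, 1) \<otimes>\<^bsub>?G\<^esub> x)
      + f (1, 0) * g ((1, 0) \<otimes>\<^bsub>?G\<^esub> x) + f (1, 1) * g ((1, 1) \<otimes>\<^bsub>?G\<^esub> x)"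
  proof -
    have "(\<Sum>y\<in>carrier ?G. f y * g (inv\<^bsub>?G\<^esub> y \<otimes>\<^bsub>?G\<^esub> x)) =
        (\<Sum>y\<in>carrier ?G. f y * g (y \<otimes>\<^bsub>?G\<^esub> x))"
      by (rule sum.cong) (simp_all add: inv del: carrier_DirProd)
    then show ?thesis unfolding carrier_klein_four_group by (simp add: add.assoc)
  qed
  show "(f \<otimes>\<^bsub>klein_algebra\<^esub> g) x = ?rhs x"
  proof (cases "x \<in> carrier ?G")
    case True
    then consider "x = (0, 0)" | "x = (0, 1)" | "x = (1, 0)" | "x = (1, 1)"
      unfolding carrier_klein_four_group by blast
    then show ?thesis using True unfolding conv sum by cases simp_all
  next
    case False
    then show ?thesis unfolding conv by (auto simp: klein_elt_def carrier_klein_four_group)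
  qed
qed

lemma klein_scale:
  assumes "f \<in> carrier klein_algebra"
  shows "klein_elt c 0 0 0 \<otimes>\<^bsub>klein_algebra\<^esub> f = (\<lambda>x. c * f x)"
proof -
  have "(\<lambda>x. c * f x) \<in> carrier klein_algebra"
    using assms unfolding klein_carrier by simp
  then show ?thesis
    by (intro klein_ext) (simp_all add: klein_mult)
qed

lemma augmentation_mult:
  assumes "f \<in> carrier klein_algebra"
  shows "augmentation (f \<otimes>\<^bsub>klein_algebra\<^esub> g) = augmentation f * augmentation g"
  using assms by (simp add: klein_mult augmentation_def algebra_simps)

lemma klein_cring: "cring (klein_algebra :: ('k::field, _) module)"
proof -
  interpret ring "klein_algebra :: ('k, _) module"
    by (rule group_algebra_ring[OF group_klein_four_group])
  show ?thesis
  proof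
    fix f g :: "int \<times> int \<Rightarrow> 'k"
    assume "f \<in> carrier klein_algebra" "g \<in> carrier klein_algebra"
    then show "f \<otimes>\<^bsub>klein_algebra\<^esub> g = g \<otimes>\<^bsub>klein_algebra\<^esub> f"
      by (simp add: klein_mult algebra_simps)
  qed
qed

lemma CHAR_2_imp_two_eq_zero:
  assumes "CHAR('a::semiring_1) = 2"
  shows "(2 :: 'a) = 0"
  using of_nat_CHAR[where ?'a = 'a] assms by simp

text \<open>The identity that makes the algebra local: all cross terms occur twice, hence vanish, and each group
  element squares to the identity.\<close>

lemma klein_square:
  fixes f :: "int \<times> int \<Rightarrow> 'k::field"
  assumes "CHAR('k) = 2" "f \<in> carrier klein_algebra"
  shows "f \<otimes>\<^bsub>klein_algebra\<^esub> f = klein_elt ((augmentation f)\<^sup>2) 0 0 0"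
  unfolding klein_mult[OF assms(2)] augmentation_def
  by (intro arg_cong4[where f = klein_elt])
    (simp_all add: power2_eq_square algebra_simps CHAR_2_imp_two_eq_zero[OF assms(1)])

lemma klein_local_nil_ring:
  assumes "CHAR('k::field) = 2"
  shows "local_nil_ring (klein_algebra :: ('k, _) module)"
proof -
  interpret cring "klein_algebra :: ('k, _) module" by (rule klein_cring)
  show ?thesis
  proof
    show "\<one>\<^bsub>klein_algebra\<^esub> \<noteq> (\<zero>\<^bsub>klein_algebra\<^esub> :: int \<times> int \<Rightarrow> 'k)"
      by (auto simp: klein_one dest: fun_cong[of _ _ "(0, 0)"])
    fix f :: "int \<times> int \<Rightarrow> 'k"
    assume f: "f \<in> carrier klein_algebra"
    note sq = klein_square[OF assms f]
    show "f \<in> Units klein_algebra \<or> (\<exists>n::nat. f [^]\<^bsub>klein_algebra\<^esub> n = \<zero>\<^bsub>klein_algebra\<^esub>)"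
    proof (cases "augmentation f = 0")
      case True
      then have "f [^]\<^bsub>klein_algebra\<^esub> Suc (Suc 0) = \<zero>\<^bsub>klein_algebra\<^esub>"
        using f sq by simp
      then show ?thesis by blast
    next
      case False
      let ?c = "klein_elt (inverse ((augmentation f)\<^sup>2)) 0 0 0"
      have "f \<otimes>\<^bsub>klein_algebra\<^esub> (f \<otimes>\<^bsub>klein_algebra\<^esub> ?c) = (f \<otimes>\<^bsub>klein_algebra\<^esub> f) \<otimes>\<^bsub>klein_algebra\<^esub> ?c"
        using f by (simp add: m_assoc)
      also have "\<dots> = \<one>\<^bsub>klein_algebra\<^esub>"
        unfolding sq using False by (simp add: klein_mult klein_one)
      finally have "f \<otimes>\<^bsub>klein_algebra\<^esub> (f \<otimes>\<^bsub>klein_algebra\<^esub> ?c) = \<one>\<^bsub>klein_algebra\<^esub>" .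
      moreover have "f \<otimes>\<^bsub>klein_algebra\<^esub> ?c \<in> carrier klein_algebra" using f by simp
      ultimately have "f \<in> Units klein_algebra"
        using f m_comm[of f "f \<otimes>\<^bsub>klein_algebra\<^esub> ?c"] unfolding Units_def by auto
      then show ?thesis ..
    qed
  qed
qed

lemma klein_unit_augmentation:
  fixes f :: "int \<times> int \<Rightarrow> 'k::field"
  assumes "f \<in> Units klein_algebra"
  shows "augmentation f \<noteq> 0"
proof
  interpret cring "klein_algebra :: ('k, _) module" by (rule klein_cring)
  assume "augmentation f = 0"
  then have "augmentation (\<one>\<^bsub>klein_algebra\<^esub> :: int \<times> int \<Rightarrow> 'k) = 0"
    using augmentation_mult[OF Units_closed[OF assms]] Units_r_inv[OF assms] by (metis mult_zero_left)
  then show False by (simp add: klein_one augmentation_def)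
qed

text \<open>All functions form the vector space here, as its dimension theory needs a whole type. The group
  algebra and its submodules are subspaces.\<close>

interpretation pointwise: vector_space "\<lambda>(c::'k::field) (f::int \<times> int \<Rightarrow> 'k) x. c * f x"
  by unfold_locales (auto simp: fun_eq_iff algebra_simps)

lemma klein_submodule_iff:
  fixes N :: "(int \<times> int \<Rightarrow> 'k::field) set"
  shows "left_submodule klein_algebra (regular_module klein_algebra) N \<longleftrightarrow>
    N \<subseteq> carrier klein_algebra \<and> (\<lambda>x. 0) \<in> N \<and> (\<forall>f\<in>N. \<forall>g\<in>N. (\<lambda>x. f x + g x) \<in> N) \<and>
    (\<forall>a\<in>carrier klein_algebra. \<forall>f\<in>N. a \<otimes>\<^bsub>klein_algebra\<^esub> f \<in> N)"
proof -
  interpret left_module "klein_algebra :: ('k, _) module" "regular_module klein_algebra"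
    by (rule ring.regular_left_module[OF group_algebra_ring[OF group_klein_four_group]])
  show ?thesis unfolding left_submodule_iff by simp
qed

lemma klein_submodule_subspace:
  assumes "left_submodule klein_algebra (regular_module klein_algebra) N"
  shows "pointwise.subspace N"
proof (rule pointwise.subspaceI)
  note N = assms[unfolded klein_submodule_iff]
  show "0 \<in> N" using N by (simp add: zero_fun_def)
  show "f + g \<in> N" if "f \<in> N" "g \<in> N" for f g using N that by (simp add: plus_fun_def)
  show "(\<lambda>x. c * f x) \<in> N" if f: "f \<in> N" for c f
  proof -
    have "klein_elt c 0 0 0 \<otimes>\<^bsub>klein_algebra\<^esub> f \<in> N" using N f by blast
    moreover have "f \<in> carrier klein_algebra" using N f by blast
    ultimately show ?thesis using klein_scale[of f c] by simp
  qed
qed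

text \<open>A basis of each member of the series arises from one of its predecessor by adding a single vector
  \<open>f\<close>. Indeed every \<open>g\<close> in the larger module is \<open>n + a f\<close> with \<open>n\<close> in the smaller one; splitting \<open>a\<close>
  into the scalar \<open>\<epsilon>(a)\<close> and the non-unit \<open>a - \<epsilon>(a)\<close>, whose product with \<open>f\<close> lies in the smaller module,
  leaves \<open>g\<close> as a scalar multiple of \<open>f\<close> modulo the smaller module.\<close>

lemma klein_series_length:
  assumes char: "CHAR('k::field) = 2"
    and cs: "composition_series klein_algebra (regular_module (klein_algebra :: ('k, _) module)) Ns"
  shows "length Ns = Suc (pointwise.dim (carrier (klein_algebra :: ('k, _) module)))"
proof -
  let ?A = "klein_algebra :: ('k, _) module"
  interpret local_nil_ring ?A by (rule klein_local_nil_ring[OF char])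
  note cs' = cs[unfolded composition_series_iff[OF regular_left_module]]
  have basis: "\<exists>B. finite B \<and> card B = i \<and> pointwise.independent B \<and> pointwise.span B = Ns ! i"
    if "i < length Ns" for i
    using that
  proof (induction i)
    case 0
    then have "Ns ! 0 = {0}" using cs' hd_conv_nth[of Ns] by (auto simp: zero_fun_def)
    then show ?case by (intro exI[of _ "{}"]) (simp add: pointwise.independent_empty)
  next
    case (Suc i)
    then obtain B where B: "finite B" "card B = i" "pointwise.independent B" "pointwise.span B = Ns ! i"
      by auto
    have step: "simple_step ?A (regular_module ?A) (Ns ! i) (Ns ! Suc i)"
      and sub: "left_submodule ?A (regular_module ?A) (Ns ! Suc i)"
      using cs' Suc.prems by auto
    obtain f where f: "f \<in> Ns ! Suc i" "f \<notin> Ns ! i" using step by (auto simp: simple_step_def)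
    have fA: "f \<in> carrier ?A" using sub f(1) by (auto simp: klein_submodule_iff)
    have nf: "f \<notin> pointwise.span B" using f(2) B(4) by simp
    have "Ns ! Suc i \<subseteq> pointwise.span (insert f B)"
    proof
      fix g assume "g \<in> Ns ! Suc i"
      then obtain a n where a: "a \<in> carrier ?A" and n: "n \<in> Ns ! i" and g: "g = n \<oplus>\<^bsub>?A\<^esub> a \<otimes>\<^bsub>?A\<^esub> f"
        using step[unfolded simple_step_def regular_module_simps] f by (metis DiffI)
      \<comment> \<open>The splitting of \<open>a\<close> into the non-unit \<open>b\<close> and the scalar \<open>c\<close>.\<close>
      define c where "c = augmentation a"
      define b where "b = klein_elt (a (0, 0) - c) (a (0, 1)) (a (1, 0)) (a (1, 1))"
      have bA: "b \<in> carrier ?A" by (simp add: b_def)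
      have "b \<notin> Units ?A"
        using klein_unit_augmentation[of b] by (auto simp: b_def c_def augmentation_def)
      then have "b \<otimes>\<^bsub>?A\<^esub> f \<in> Ns ! i"
        using nonunit_composition_series[OF regular_left_module cs Suc.prems _ _ f(1), of b]
        by (simp add: b_def)
      then have "n + (b \<otimes>\<^bsub>?A\<^esub> f) \<in> pointwise.span B"
        using n B(4) by (intro pointwise.span_add) auto
      moreover have "g - (\<lambda>x. c * f x) = n + (b \<otimes>\<^bsub>?A\<^esub> f)"
      proof -
        have "a = b \<oplus>\<^bsub>?A\<^esub> klein_elt c 0 0 0"
          by (rule klein_ext) (use a in \<open>auto simp: klein_carrier b_def klein_elt_def\<close>)
        then have "a \<otimes>\<^bsub>?A\<^esub> f = b \<otimes>\<^bsub>?A\<^esub> f \<oplus>\<^bsub>?A\<^esub> klein_elt c 0 0 0 \<otimes>\<^bsub>?A\<^esub> f"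
          using l_distr[OF bA klein_elt_carrier[of c 0 0 0] fA] by (rule trans[OF arg_cong[of _ _ "\<lambda>z. z \<otimes>\<^bsub>?A\<^esub> f"]])
        then show ?thesis unfolding g by (auto simp: klein_scale[OF fA])
      qed
      ultimately show "g \<in> pointwise.span (insert f B)"
        unfolding pointwise.span_breakdown_eq by metis
    qed
    moreover have "pointwise.span (insert f B) \<subseteq> Ns ! Suc i"
    proof (rule pointwise.span_minimal[OF _ klein_submodule_subspace[OF sub]])
      have "B \<subseteq> Ns ! i" unfolding B(4)[symmetric] by (rule pointwise.span_superset)
      then show "insert f B \<subseteq> Ns ! Suc i" using step f(1) by (auto simp: simple_step_def)
    qed
    moreover have "f \<notin> B" using nf pointwise.span_base by blast
    ultimately show ?case
      using B nf pointwise.independent_insertI[OF nf B(3)] by (intro exI[of _ "insert f B"]) auto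
  qed
  have "Ns \<noteq> []" "last Ns = carrier ?A" using cs' by auto
  then obtain B where "card B = length Ns - 1" "pointwise.independent B"
    "pointwise.span B = carrier ?A"
    using basis[of "length Ns - 1"] by (auto simp: last_conv_nth)
  then have "pointwise.dim (carrier ?A) = length Ns - 1"
    using pointwise.dim_eq_card[of B "carrier ?A"] by (metis pointwise.span_span)
  then show ?thesis using \<open>Ns \<noteq> []\<close> by (cases Ns) auto
qed

text \<open>The kernel of a nonzero linear form on \<open>N'\<close> has codimension one, so scalars alone already generate
  \<open>N'\<close> from any element outside it.\<close>

lemma klein_simple_stepI:
  fixes l :: "(int \<times> int \<Rightarrow> 'k::field) \<Rightarrow> 'k"
  assumes sub: "left_submodule klein_algebra (regular_module klein_algebra) N'"
    and add: "\<And>f g. l (\<lambda>x. f x + g x) = l f + l g"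
    and scale: "\<And>c f. l (\<lambda>x. c * f x) = c * l f"
    and ker: "N = {f \<in> N'. l f = 0}" and nz: "f\<^sub>0 \<in> N'" "l f\<^sub>0 \<noteq> 0"
  shows "simple_step klein_algebra (regular_module klein_algebra) N N'"
  unfolding simple_step_def
proof (intro conjI ballI)
  show "N \<subset> N'" using ker nz by blast
  fix f g assume f: "f \<in> N' - N" and g: "g \<in> N'"
  have N': "N' \<subseteq> carrier klein_algebra"
    "\<And>f g. f \<in> N' \<Longrightarrow> g \<in> N' \<Longrightarrow> (\<lambda>x. f x + g x) \<in> N'"
    "\<And>a f. a \<in> carrier klein_algebra \<Longrightarrow> f \<in> N' \<Longrightarrow> a \<otimes>\<^bsub>klein_algebra\<^esub> f \<in> N'"
    using sub[unfolded klein_submodule_iff] by simp_all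
  have fA: "f \<in> carrier klein_algebra" using f N'(1) by auto
  have lf: "l f \<noteq> 0" using f ker by auto
  define c where "c = l g / l f"
  define n where "n = (\<lambda>x. g x + (- c) * f x)"
  have "klein_elt (- c) 0 0 0 \<otimes>\<^bsub>klein_algebra\<^esub> f \<in> N'" using f by (intro N'(3)) auto
  then have "(\<lambda>x. (- c) * f x) \<in> N'" unfolding klein_scale[OF fA] .
  then have "n \<in> N'" unfolding n_def by (rule N'(2)[OF g])
  moreover have "l n = 0"
    unfolding n_def add scale using lf by (simp add: c_def)
  ultimately have "n \<in> N" using ker by simp
  moreover have "g = n \<oplus>\<^bsub>klein_algebra\<^esub> klein_elt c 0 0 0 \<otimes>\<^bsub>klein_algebra\<^esub> f"
    unfolding klein_scale[OF fA] n_def by simp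
  ultimately show "\<exists>a\<in>carrier klein_algebra. \<exists>n\<in>N.
      g = n \<oplus>\<^bsub>regular_module klein_algebra\<^esub> a \<odot>\<^bsub>regular_module klein_algebra\<^esub> f"
    unfolding regular_module_simps by (intro bexI[of _ "klein_elt c 0 0 0"] bexI[of _ n]) auto
qed

text \<open>Above zero: the multiples of the sum of all group elements (the socle), the functions constant on the
  cosets of \<open>{1, h}\<close> (the elements fixed by \<open>h\<close>), the augmentation ideal (the radical), and everything.\<close>

definition klein_series :: "(int \<times> int \<Rightarrow> 'k::field) set list"
  where "klein_series =
    [{\<lambda>x. 0},
     {f \<in> carrier klein_algebra. f (0, 1) = f (0, 0) \<and> f (1, 0) = f (0, 0) \<and> f (1, 1) = f (0, 0)},
     {f \<in> carrier klein_algebra. f (0, 1) = f (0, 0) \<and> f (1, 1) = f (1, 0)},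
     {f \<in> carrier klein_algebra. augmentation f = 0},
     carrier klein_algebra]"

lemma klein_composition_series:
  assumes char: "CHAR('k::field) = 2"
  shows "composition_series klein_algebra (regular_module (klein_algebra :: ('k, _) module)) klein_series"
proof -
  let ?A = "klein_algebra :: ('k, _) module"
  let ?M = "regular_module ?A"
  let ?N1 = "{f \<in> carrier ?A. f (0, 1) = f (0, 0) \<and> f (1, 0) = f (0, 0) \<and> f (1, 1) = f (0, 0)}"
  let ?N2 = "{f \<in> carrier ?A. f (0, 1) = f (0, 0) \<and> f (1, 1) = f (1, 0)}"
  let ?N3 = "{f \<in> carrier ?A. augmentation f = 0}"
  interpret cring ?A by (rule klein_cring)
  note two = CHAR_2_imp_two_eq_zero[OF char]
  have M: "left_module ?A ?M" by (rule regular_left_module)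
  have add: "(\<lambda>x. f x + g x) \<in> carrier ?A" if "f \<in> carrier ?A" "g \<in> carrier ?A" for f g
    using a_closed[OF that] by simp
  have zero: "(\<lambda>x. 0) \<in> carrier ?A" using zero_closed by simp
  have s0: "left_submodule ?A ?M {\<lambda>x. 0}"
    unfolding klein_submodule_iff using zero r_null by auto
  have s1: "left_submodule ?A ?M ?N1"
    unfolding klein_submodule_iff
  proof (intro conjI ballI)
    show "a \<otimes>\<^bsub>?A\<^esub> f \<in> ?N1" if "a \<in> carrier ?A" "f \<in> ?N1" for a f
      using that by (simp add: klein_mult algebra_simps)
  qed (use zero add in auto)
  have s2: "left_submodule ?A ?M ?N2"
    unfolding klein_submodule_iff
  proof (intro conjI ballI)
    show "a \<otimes>\<^bsub>?A\<^esub> f \<in> ?N2" if "a \<in> carrier ?A" "f \<in> ?N2" for a f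
      using that by (simp add: klein_mult algebra_simps)
  qed (use zero add in auto)
  have s3: "left_submodule ?A ?M ?N3"
    unfolding klein_submodule_iff using zero add
    by (auto simp: augmentation_mult) (auto simp: augmentation_def algebra_simps)
  have s4: "left_submodule ?A ?M (carrier ?A)"
    unfolding klein_submodule_iff using zero add by auto
  have t0: "simple_step ?A ?M {\<lambda>x. 0} ?N1"
  proof (rule klein_simple_stepI[OF s1, where l = "\<lambda>f. f (0, 0)" and f\<^sub>0 = "klein_elt 1 1 1 1"])
    show "{\<lambda>x. 0} = {f \<in> ?N1. f (0, 0) = 0}"
      using zero by (auto intro: klein_ext)
  qed auto
  have t1: "simple_step ?A ?M ?N1 ?N2"
    by (rule klein_simple_stepI[OF s2, where l = "\<lambda>f. f (0, 0) - f (1, 0)" and f\<^sub>0 = "klein_elt 1 1 0 0"])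
      (auto simp: algebra_simps)
  have t2: "simple_step ?A ?M ?N2 ?N3"
  proof (rule klein_simple_stepI[OF s3, where l = "\<lambda>f. f (0, 0) - f (0, 1)" and f\<^sub>0 = "klein_elt 1 0 1 0"])
    \<comment> \<open>With equal coefficients at \<open>1\<close> and \<open>h\<close>, the augmentation is the sum of the other two.\<close>
    have "y + z = 0 \<longleftrightarrow> z = y" for y z :: 'k
      using two by (metis add.commute add_left_cancel mult_2 mult_zero_left)
    then show "?N2 = {f \<in> ?N3. f (0, 0) - f (0, 1) = 0}"
      by (auto simp: augmentation_def two)
  qed (auto simp: augmentation_def two algebra_simps)
  have t3: "simple_step ?A ?M ?N3 (carrier ?A)"
    by (rule klein_simple_stepI[OF s4, where l = augmentation and f\<^sub>0 = "klein_elt 1 0 0 0"])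
      (auto simp: augmentation_def algebra_simps)
  show ?thesis
    unfolding composition_series_iff[OF M] klein_series_def
    using s0 s1 s2 s3 s4 t0 t1 t2 t3 by (auto simp: less_Suc_eq nth_Cons split: nat.splits)
qed

theorem mainTheorem2:
  fixes A :: "('k::alg_closed_field, int \<times> int \<Rightarrow> 'k) module"
  assumes "CHAR('k) = 2"
    and "A = group_algebra klein_four_group"
  shows "\<exists>\<S>. simple_module_types A = {\<S>} \<and> cartan_matrix A \<S> \<S> = 4"
proof -
  interpret local_nil_ring A unfolding assms(2) by (rule klein_local_nil_ring[OF assms(1)])
  have series: "composition_series A (regular_module A) klein_series"
    unfolding assms(2) by (rule klein_composition_series[OF assms(1)])
  have "length Ms = Suc 4" if "composition_series A (regular_module A) Ms" for Ms
    using klein_series_length[OF assms(1) that[unfolded assms(2)]]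
      klein_series_length[OF assms(1) series[unfolded assms(2)]]
    by (simp add: klein_series_def)
  from cartan_matrix_local[OF series this] show ?thesis by blast
qed

end
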